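(* Let $H$ be a separable infinite dimensional complex Hilbert space. Then for a generic $u\in\mathcal{U}(H)$ (i.e. for all $u$ in a comeager subset of $\mathcal{U}(H)$) the following holds: for all $l,l'\geq 1$ and all positive integers $k(1),\dots,k(l)$ and $k'(1),\dots,k'(l')$, the convolutions \[ \sigma_{u^{k(1)}}\ast\cdots\ast\sigma_{u^{k(l)}}\quad\text{and}\quad \sigma_{u^{k'(1)}}\ast\cdots\ast\sigma_{u^{k'(l')}} \] are mutually singular, provided that there does not exist $r\in S_l$ such that $(k'(1),\dots,k'(l'))=r(k(1),\dots,k(l))$.
   Context: $\mathcal{U}(H)$ is the group of unitary operators on $H$ with the strong operator topology (a Polish group). A subset of a Polish space is comeager if it contains a countable intersection of dense open sets. For a unitary operator $u$ on $H$, $\sigma_u$ denotes its maximal spectral type, a finite Borel measure on the unit circle $\mathbb{T}$ determined up to mutual absolute continuity. Convolution $\ast$ is convolution of finite measures on the group $\mathbb{T}$. $S_l$ is the permutation group of $\{1,\dots,l\}$ and $r(k(1),\dots,k(l))=(k(r(1)),\dots,k(r(l)))$; the equality $(k'(1),\dots,k'(l'))=r(k(1),\dots,k(l))$ includes $l=l'$. *)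

theory Defs
  imports "HOL-Analysis.Analysis" "HOL-Combinatorics.Combinatorics"
begin

section \<open>Complex Hilbert spaces\<close>

text \<open>
  The inner product is linear in the first argument. The real vector space structure inherited from
  \<^class>\<open>banach\<close> is the restriction of scalars of the complex one, and the norm (hence the topology
  and completeness) is the one induced by the inner product.
\<close>

class complex_hilbert_space = banach +
  fixes scaleC :: "complex \<Rightarrow> 'a \<Rightarrow> 'a" (infixr \<open>*\<^sub>C\<close> 75)
    and cinner :: "'a \<Rightarrow> 'a \<Rightarrow> complex"
  assumes scaleC_add_right: "a *\<^sub>C (x + y) = a *\<^sub>C x + a *\<^sub>C y"
    and scaleC_add_left: "(a + b) *\<^sub>C x = a *\<^sub>C x + b *\<^sub>C x"
    and scaleC_scaleC: "a *\<^sub>C b *\<^sub>C x = (a * b) *\<^sub>C x"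
    and scaleC_one: "1 *\<^sub>C x = x"
    and scaleC_of_real: "complex_of_real r *\<^sub>C x = r *\<^sub>R x"
    and cinner_commute: "cinner x y = cnj (cinner y x)"
    and cinner_add_left: "cinner (x + y) z = cinner x z + cinner y z"
    and cinner_scaleC_left: "cinner (a *\<^sub>C x) y = a * cinner x y"
    and cinner_ge_zero: "0 \<le> Re (cinner x x)"
    and cinner_eq_zero_iff: "cinner x x = 0 \<longleftrightarrow> x = 0"
    and norm_eq_sqrt_cinner: "norm x = sqrt (Re (cinner x x))"

definition infinite_dimensional :: "'h::complex_hilbert_space itself \<Rightarrow> bool" where
  "infinite_dimensional _ \<longleftrightarrow>
     \<not> (\<exists>B::'h set. finite B \<and> module.span scaleC B = UNIV)"


section \<open>The unitary group and genericity\<close>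

definition unitary_operator :: "('h::complex_hilbert_space \<Rightarrow> 'h) \<Rightarrow> bool" where
  "unitary_operator u \<longleftrightarrow>
     (\<forall>x y. u (x + y) = u x + u y) \<and>
     (\<forall>a x. u (a *\<^sub>C x) = a *\<^sub>C u x) \<and>
     (\<forall>x y. cinner (u x) (u y) = cinner x y) \<and>
     surj u"

definition unitary_group :: "('h::complex_hilbert_space \<Rightarrow>\<^sub>L 'h) topology" where
  "unitary_group = subtopology strong_operator_topology {u. unitary_operator (blinfun_apply u)}"

definition comeager_in :: "'a topology \<Rightarrow> 'a set \<Rightarrow> bool" where
  "comeager_in X A \<longleftrightarrow>
     A \<subseteq> topspace X \<and>
     (\<exists>\<U>. countable \<U> \<and>
          (\<forall>U\<in>\<U>. openin X U \<and> X closure_of U = topspace X) \<and>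
          topspace X \<inter> \<Inter>\<U> \<subseteq> A)"


section \<open>Finite Borel measures on the unit circle\<close>

definition circle_borel :: "complex measure" where
  "circle_borel = restrict_space borel (sphere 0 1)"

definition finite_circle_measure :: "complex measure \<Rightarrow> bool" where
  "finite_circle_measure \<mu> \<longleftrightarrow> finite_measure \<mu> \<and> sets \<mu> = sets circle_borel"

definition circle_convolution :: "complex measure \<Rightarrow> complex measure \<Rightarrow> complex measure" where
  "circle_convolution \<mu> \<nu> = distr (\<mu> \<Otimes>\<^sub>M \<nu>) circle_borel (\<lambda>(z, w). z * w)"

text \<open>Only meaningful for nonempty lists.\<close>

definition circle_convolutions :: "complex measure list \<Rightarrow> complex measure" where
  "circle_convolutions \<mu>s = foldl circle_convolution (hd \<mu>s) (tl \<mu>s)"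

definition mutually_singular :: "'a measure \<Rightarrow> 'a measure \<Rightarrow> bool" where
  "mutually_singular \<mu> \<nu> \<longleftrightarrow>
     sets \<mu> = sets \<nu> \<and>
     (\<exists>A\<in>sets \<mu>. emeasure \<mu> A = 0 \<and> emeasure \<nu> (space \<nu> - A) = 0)"


section \<open>Spectral measures and the maximal spectral type\<close>

definition operator_powi :: "('h \<Rightarrow> 'h) \<Rightarrow> int \<Rightarrow> 'h \<Rightarrow> 'h" where
  "operator_powi u n = (if 0 \<le> n then u ^^ nat n else inv u ^^ nat (- n))"

text \<open>The spectral measure of a vector is the measure whose Fourier--Stieltjes coefficients are the
  matrix coefficients of the powers of the operator.\<close>

definition spectral_measure ::
    "('h::complex_hilbert_space \<Rightarrow> 'h) \<Rightarrow> 'h \<Rightarrow> complex measure \<Rightarrow> bool" where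
  "spectral_measure u \<xi> \<mu> \<longleftrightarrow>
     finite_circle_measure \<mu> \<and>
     (\<forall>n::int. (LINT z|\<mu>. z powi n) = cinner (operator_powi u n \<xi>) \<xi>)"

text \<open>
  The maximal spectral type is a measure class, so it is rendered as the predicate that
  \<open>\<sigma>\<close> is a representative of it: \<open>\<sigma>\<close> is equivalent to the spectral measure of some vector, and the
  spectral measure of every vector is absolutely continuous with respect to \<open>\<sigma>\<close>. Note that
  \<^term>\<open>absolutely_continuous \<mu> \<nu>\<close> means that \<open>\<nu>\<close> is absolutely continuous with respect to \<open>\<mu>\<close>.
\<close>

definition maximal_spectral_type ::
    "('h::complex_hilbert_space \<Rightarrow> 'h) \<Rightarrow> complex measure \<Rightarrow> bool" where
  "maximal_spectral_type u \<sigma> \<longleftrightarrow>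
     finite_circle_measure \<sigma> \<and>
     (\<exists>\<xi> \<mu>. spectral_measure u \<xi> \<mu> \<and>
            absolutely_continuous \<mu> \<sigma> \<and> absolutely_continuous \<sigma> \<mu>) \<and>
     (\<forall>\<xi> \<mu>. spectral_measure u \<xi> \<mu> \<longrightarrow> absolutely_continuous \<sigma> \<mu>)"

end

theory Submission
  imports Defs
begin

text \<open>
  Different convolutions are told apart by the weak limits of one sequence of characters. Suppose that
  along some sequence \<open>n\<close> the powers \<open>u ^ (k * n j)\<close> converge weakly to a scalar \<open>c k\<close>, for every \<open>k\<close>. In terms
  of spectral measures this says that the characters \<open>z ^ n j\<close> converge weakly to the constant \<open>c k\<close> with
  respect to every spectral measure of \<open>u\<^sup>k\<close>, hence with respect to \<open>\<sigma> k\<close>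
  (\<open>weak_multiplier_spectral_measure\<close>, \<open>weak_multiplier_absolutely_continuous\<close>). Characters turn
  convolutions into products, so with respect to the convolution along a tuple \<open>ks\<close> they converge
  weakly to the product of the \<open>c k\<close> over \<open>ks\<close> (\<open>weak_multiplier_convolutions\<close>). Two measures
  for which the same characters have different constant weak limits cannot both dominate the same nonzero
  measure (\<open>mutually_singular_if_weak_multipliers_differ\<close>).

  It remains to supply enough sequences. The limits used are the Fourier coefficients
  \<open>c k = (1 - p) + p * cis (k * \<theta>)\<close> of two-point measures. As a function of \<open>p\<close>, their product over \<open>ks\<close>
  is a polynomial with roots \<open>1 / (1 - cis (k * \<theta>))\<close>; for small \<open>\<theta>\<close> these roots determine the multiset
  of \<open>ks\<close>, so countably many pairs \<open>(p, \<theta>)\<close> separate all tuples that are not permutations of each other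
  (\<open>mset_eq_if_two_point_coefficients_eq\<close>).

  For a fixed pair, the unitaries having a power sequence with these limits contain a countable intersection
  of open sets, and each of these sets is dense: near every unitary, and on every finite set of
  vectors, there is a unitary \<open>v\<close> for which \<open>v ^ (k * M)\<close> acts exactly as \<open>c k\<close> in the weak sense
  (\<open>unitary_twisted_tower_near\<close>). Such a \<open>v\<close> moves \<open>M\<close> orthogonal copies of a finite-dimensional space
  cyclically, in two towers, and picks up the phase \<open>1\<close> or \<open>cis \<theta>\<close> once per round trip. The
  vector \<open>x\<close> is placed as the normalized sum of the copies of \<open>u\<^sup>j x\<close>, so that \<open>v\<close> agrees with
  \<open>u\<close> up to one of \<open>M\<close> summands.
\<close>

section \<open>Hilbert space preliminaries\<close>

lemma cinner_zero_left [simp]: "cinner 0 (y :: 'h::complex_hilbert_space) = 0"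
  using cinner_add_left[of 0 0 y] by simp

lemma cinner_minus_left [simp]: "cinner (- x) y = - cinner x y"
  using cinner_add_left[of x "- x" y] by (simp add: add_eq_0_iff)

lemma cinner_diff_left: "cinner (x - y) z = cinner x z - cinner y z"
  using cinner_add_left[of x "- y" z] by simp

lemma cinner_add_right: "cinner x (y + z) = cinner x y + cinner x z"
  by (metis cinner_commute cinner_add_left complex_cnj_add)

lemma cinner_zero_right [simp]: "cinner x 0 = 0"
  by (metis cinner_commute cinner_zero_left complex_cnj_zero)

lemma cinner_diff_right: "cinner x (y - z) = cinner x y - cinner x z"
  by (metis cinner_commute cinner_diff_left complex_cnj_diff)

lemma cinner_scaleC_right: "cinner x (a *\<^sub>C y) = cnj a * cinner x y"
  by (metis cinner_commute cinner_scaleC_left complex_cnj_mult)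

lemma cinner_sum_left: "cinner (\<Sum>i\<in>I. f i) y = (\<Sum>i\<in>I. cinner (f i) y)"
  by (induction I rule: infinite_finite_induct) (simp_all add: cinner_add_left)

lemma cinner_sum_right: "cinner x (\<Sum>i\<in>I. f i) = (\<Sum>i\<in>I. cinner x (f i))"
  by (induction I rule: infinite_finite_induct) (simp_all add: cinner_add_right)

lemma norm_sq_cinner: "(norm x)\<^sup>2 = Re (cinner x x)"
  by (simp add: norm_eq_sqrt_cinner cinner_ge_zero)

lemma cinner_self: "cinner x x = complex_of_real ((norm x)\<^sup>2)"
proof -
  have "Im (cinner x x) = 0"
    using cinner_commute[of x x] by (metis complex_cnj_cancel_iff complex_eq_iff cnj.simps(2) equal_neg_zero)
  then show ?thesis by (simp add: complex_eq_iff norm_sq_cinner)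
qed

lemma scaleC_zero_left [simp]: "0 *\<^sub>C (x :: 'h::complex_hilbert_space) = 0"
  using scaleC_of_real[of 0 x] by simp

lemma scaleC_diff_right: "a *\<^sub>C (x - y) = a *\<^sub>C x - a *\<^sub>C y"
  using scaleC_add_right[of a "x - y" y] by (simp add: algebra_simps)

lemma norm_scaleC: "norm (a *\<^sub>C x) = cmod a * norm x"
proof -
  have "cinner (a *\<^sub>C x) (a *\<^sub>C x) = of_real ((cmod a * norm x)\<^sup>2)"
    by (simp add: cinner_scaleC_left cinner_scaleC_right cinner_self[of x] power_mult_distrib
        complex_norm_square del: of_real_power)
  then have "(norm (a *\<^sub>C x))\<^sup>2 = (cmod a * norm x)\<^sup>2"
    by (simp only: norm_sq_cinner Re_complex_of_real)
  then show ?thesis by (simp add: power2_eq_iff_nonneg)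
qed

lemma module_scaleC: "module (scaleC :: _ \<Rightarrow> 'h::complex_hilbert_space \<Rightarrow> _)"
  unfolding module_def by (auto simp: scaleC_add_right scaleC_add_left scaleC_scaleC scaleC_one)

lemma Cauchy_Schwarz: "cmod (cinner x y) \<le> norm x * norm y"
proof (cases "y = 0")
  case False
  define n where "n = (norm y)\<^sup>2"
  have n: "n > 0" using False by (simp add: n_def)
  define c where "c = cinner x y"
  define a where "a = c / of_real n"
  have cyx: "cinner y x = cnj c" unfolding c_def by (rule cinner_commute)
  have "cinner (x - a *\<^sub>C y) (x - a *\<^sub>C y)
      = of_real ((norm x)\<^sup>2) - cnj a * c - a * cnj c + a * cnj a * of_real n"
    by (simp add: cinner_diff_left cinner_diff_right cinner_scaleC_left cinner_scaleC_right
        cinner_self[of x] cinner_self[of y] cyx del: of_real_power flip: n_def c_def) (simp add: algebra_simps)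
  also have "\<dots> = of_real ((norm x)\<^sup>2 - (cmod c)\<^sup>2 / n)"
    using n by (simp add: a_def complex_norm_square divide_simps del: of_real_power)
  finally have "0 \<le> (norm x)\<^sup>2 - (cmod c)\<^sup>2 / n"
    using cinner_ge_zero[of "x - a *\<^sub>C y"] by (metis Re_complex_of_real)
  then have "(cmod c)\<^sup>2 \<le> (norm x * norm y)\<^sup>2"
    using n by (simp add: field_simps power_mult_distrib n_def)
  then show ?thesis by (simp add: c_def power2_le_iff_abs_le)
qed simp

lemma tendsto_cinner:
  fixes f :: "_ \<Rightarrow> 'h::complex_hilbert_space"
  assumes "(f \<longlongrightarrow> x) F"
  shows "((\<lambda>a. cinner (f a) y) \<longlongrightarrow> cinner x y) F"
proof -
  have "((\<lambda>a. norm (f a - x) * norm y) \<longlongrightarrow> 0) F"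
    using tendsto_mult_left_zero[OF tendsto_norm_zero[OF LIM_zero[OF assms]]] .
  then have "((\<lambda>a. cinner (f a) y - cinner x y) \<longlongrightarrow> 0) F"
    by (rule Lim_null_comparison[rotated]) (auto intro!: always_eventually simp: Cauchy_Schwarz simp flip: cinner_diff_left)
  then show ?thesis by (rule LIM_zero_cancel)
qed


section \<open>Unitary operators\<close>

lemma unitary_operatorD:
  assumes "unitary_operator u"
  shows "u (x + y) = u x + u y" "u (a *\<^sub>C x) = a *\<^sub>C u x" "cinner (u x) (u y) = cinner x y" "surj u"
  using assms by (auto simp: unitary_operator_def)

lemma unitary_norm: "unitary_operator u \<Longrightarrow> norm (u x) = norm x"
  by (simp add: norm_eq_sqrt_cinner unitary_operatorD)

lemma unitary_zero: "unitary_operator u \<Longrightarrow> u 0 = 0"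
  using unitary_operatorD(2)[of u 0 0] by simp

lemma unitary_diff: "unitary_operator u \<Longrightarrow> u (x - y) = u x - u y"
  using unitary_operatorD(1)[of u "x - y" y] by (simp add: algebra_simps)

lemma unitary_sum: "unitary_operator u \<Longrightarrow> u (\<Sum>i\<in>I. f i) = (\<Sum>i\<in>I. u (f i))"
  by (induction I rule: infinite_finite_induct) (simp_all add: unitary_zero unitary_operatorD)

lemma unitary_bij: "unitary_operator u \<Longrightarrow> bij u"
proof (intro bijI injI)
  fix x y assume "unitary_operator u" "u x = u y"
  then show "x = y"
    using unitary_norm[of u "x - y"] by (simp add: unitary_diff)
qed (rule unitary_operatorD(4))

lemma unitary_id: "unitary_operator (\<lambda>x. x)"
  by (simp add: unitary_operator_def)

lemma unitary_comp: "unitary_operator u \<Longrightarrow> unitary_operator v \<Longrightarrow> unitary_operator (\<lambda>x. u (v x))"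
  using comp_surj[of v u] by (simp add: unitary_operator_def comp_def)

lemma unitary_funpow: "unitary_operator u \<Longrightarrow> unitary_operator (u ^^ n)"
proof (induction n)
  case 0 then show ?case using unitary_id by (simp add: id_def)
next
  case (Suc n) then show ?case using unitary_comp[of u "u ^^ n"] by (simp add: comp_def)
qed

lemma unitary_inv:
  assumes u: "unitary_operator u" shows "unitary_operator (inv u)"
proof -
  have b: "bij u" using u by (rule unitary_bij)
  have [simp]: "u (inv u x) = x" "inv u (u x) = x" for x
    using b by (simp_all add: bij_is_surj surj_f_inv_f bij_is_inj)
  show ?thesis unfolding unitary_operator_def
  proof (intro conjI allI)
    fix x y a
    have "inv u (x + y) = inv u (u (inv u x + inv u y))"
      by (subst unitary_operatorD(1)[OF u]) simp
    then show "inv u (x + y) = inv u x + inv u y" by simp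
    have "inv u (a *\<^sub>C x) = inv u (u (a *\<^sub>C inv u x))"
      by (subst unitary_operatorD(2)[OF u]) simp
    then show "inv u (a *\<^sub>C x) = a *\<^sub>C inv u x" by simp
    show "cinner (inv u x) (inv u y) = cinner x y"
      using unitary_operatorD(3)[OF u, of "inv u x" "inv u y"] by simp
    show "surj (inv u)" using b by (simp add: bij_betw_inv_into bij_is_surj)
  qed
qed

lemma unitary_bounded_linear:
  assumes u: "unitary_operator u" shows "bounded_linear u"
proof (rule bounded_linear_intro[where K = 1])
  show "u (r *\<^sub>R x) = r *\<^sub>R u x" for r x
    using unitary_operatorD(2)[OF u, of "of_real r" x] by (simp add: scaleC_of_real)
qed (simp_all add: unitary_norm[OF u] unitary_operatorD[OF u])

text \<open>The operator is the complex reflection in the direction \<open>d = x - y\<close> with multiplier \<open>w\<close>. The value of \<open>w\<close>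
  forced by \<open>x \<mapsto> y\<close> is unimodular because \<open>\<langle>x, d\<rangle> + \<langle>d, x\<rangle> = \<langle>d, d\<rangle>\<close> when \<open>x\<close> and \<open>y\<close> have the
  same length.\<close>

lemma unitary_reflection:
  fixes x y :: "'h::complex_hilbert_space"
  assumes nrm: "norm x = norm y"
  shows "\<exists>R. unitary_operator R \<and> R x = y \<and> (\<forall>z. cinner z x = cinner z y \<longrightarrow> R z = z)"
proof (cases "x = y")
  case True then show ?thesis using unitary_id by blast
next
  case False
  define d where "d = x - y"
  define D where "D = (norm d)\<^sup>2"
  have D: "D > 0" using False by (simp add: D_def d_def)
  have dd: "cinner d d = of_real D" by (simp add: D_def cinner_self)
  define b where "b = cinner x d"
  have bD: "b + cnj b = of_real D"
  proof -
    have "cnj b = cinner d x" unfolding b_def using cinner_commute[of d x] by simp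
    then show ?thesis
      using cinner_self[of x] cinner_self[of y] nrm
      by (simp add: b_def d_def dd[symmetric, unfolded d_def] cinner_diff_left cinner_diff_right)
  qed
  then have b0: "b \<noteq> 0" using D by auto
  define R where "R w z = z + ((w - 1) * cinner z d / of_real D) *\<^sub>C d" for w z
  have Rd: "cinner (R w z) d = w * cinner z d" for w z
    using D by (simp add: R_def cinner_add_left cinner_scaleC_left dd) (simp add: algebra_simps)
  have RR: "R w (R v z) = R (w * v) z" for w v z
  proof -
    have "R w (R v z) = z + (((v - 1) * cinner z d / of_real D) *\<^sub>C d
        + ((w - 1) * (v * cinner z d) / of_real D) *\<^sub>C d)"
      unfolding R_def[of w] Rd by (simp add: R_def)
    also have "\<dots> = R (w * v) z"
      unfolding R_def by (simp flip: scaleC_add_left add_divide_distrib) (simp add: algebra_simps)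
    finally show ?thesis .
  qed
  have R1: "R 1 z = z" for z by (simp add: R_def)
  have uni: "unitary_operator (R w)" if w: "w * cnj w = 1" for w
    unfolding unitary_operator_def
  proof (intro conjI allI)
    fix p q a
    show "R w (p + q) = R w p + R w q"
      unfolding R_def by (simp add: cinner_add_left distrib_left add_divide_distrib scaleC_add_left)
    show "R w (a *\<^sub>C p) = a *\<^sub>C R w p"
      unfolding R_def by (simp add: cinner_scaleC_left scaleC_add_right scaleC_scaleC mult.left_commute)
    have dq: "cinner d q = cnj (cinner q d)" by (rule cinner_commute)
    have alg: "v * B / E * A + (u * A / E * B + v * B / E * (u * A / E * E)) = A * B / E * (u + v + u * v)"
      if "E \<noteq> 0" for u v A B E :: complex
      using that by (simp add: field_simps)
    have "cinner (R w p) (R w q) = cinner p q + (cnj (w - 1) * cnj (cinner q d) / of_real D * cinner p d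
        + ((w - 1) * cinner p d / of_real D * cnj (cinner q d)
        + cnj (w - 1) * cnj (cinner q d) / of_real D * ((w - 1) * cinner p d / of_real D * of_real D)))"
      unfolding R_def
      by (simp only: cinner_add_left cinner_add_right cinner_scaleC_left cinner_scaleC_right dd dq
          complex_cnj_mult complex_cnj_divide complex_cnj_complex_of_real) (simp only: distrib_left add_ac mult.assoc)
    also have "\<dots> = cinner p q + cinner p d * cnj (cinner q d) / of_real D * (w * cnj w - 1)"
      using D by (subst alg) (simp_all add: algebra_simps)
    finally have "cinner (R w p) (R w q) = cinner p q + cinner p d * cnj (cinner q d) / of_real D * (w * cnj w - 1)" .
    then show "cinner (R w p) (R w q) = cinner p q" by (simp add: w)
    show "surj (R w)"
    proof (rule surjI)
      show "R w (R (cnj w) z) = z" for z by (simp add: RR w R1)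
    qed
  qed
  (* The value of the multiplier for which R w x = x - d = y. *)
  define w where "w = - cnj b / b"
  have w: "w * cnj w = 1" using b0 by (simp add: w_def)
  have "(w - 1) * b = - (b + cnj b)" using b0 by (simp add: w_def algebra_simps)
  then have "(w - 1) * b = - of_real D" using bD by simp
  then have "R w x = x + (-1) *\<^sub>C d" using D by (simp add: R_def flip: b_def)
  also have "\<dots> = y" using scaleC_of_real[of "-1" d] by (simp add: d_def)
  finally have "R w x = y" .
  moreover have "R w z = z" if "cinner z x = cinner z y" for z
    using that by (simp add: R_def d_def cinner_diff_right)
  ultimately show ?thesis using uni[OF w] by blast
qed

text \<open>The vectors are moved into place one at a time; each reflection fixes the vectors that are
  already in place, because their inner products with the old and the new position agree.\<close>

lemma unitary_extending_same_Gram: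
  fixes x y :: "'i \<Rightarrow> 'h::complex_hilbert_space"
  assumes "finite I" and "\<And>i j. i \<in> I \<Longrightarrow> j \<in> I \<Longrightarrow> cinner (x i) (x j) = cinner (y i) (y j)"
  shows "\<exists>W. unitary_operator W \<and> (\<forall>i\<in>I. W (x i) = y i)"
  using assms
proof (induction I rule: finite_induct)
  case empty then show ?case using unitary_id by blast
next
  case (insert a I)
  then obtain W where W: "unitary_operator W" "\<forall>i\<in>I. W (x i) = y i" by auto
  have "norm (W (x a)) = norm (y a)"
    using insert.prems[of a a] by (simp add: unitary_norm[OF W(1)]) (simp add: norm_eq_sqrt_cinner)
  then obtain R where R: "unitary_operator R" "R (W (x a)) = y a"
    "\<And>z. cinner z (W (x a)) = cinner z (y a) \<Longrightarrow> R z = z"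
    using unitary_reflection by blast
  have "R (W (x i)) = y i" if "i \<in> I" for i
  proof -
    have "cinner (W (x i)) (W (x a)) = cinner (y i) (y a)"
      using insert.prems[of i a] that by (simp add: unitary_operatorD(3)[OF W(1)])
    then show ?thesis using W(2) that R(3)[of "y i"] by simp
  qed
  then show ?case using unitary_comp[OF R(1) W(1)] R(2) by (intro exI[of _ "\<lambda>z. R (W z)"]) auto
qed


section \<open>Orthogonal copies of a finite set of vectors\<close>

definition orthonormal_set :: "'h::complex_hilbert_space set \<Rightarrow> bool" where
  "orthonormal_set B \<longleftrightarrow> finite B \<and> (\<forall>b\<in>B. \<forall>c\<in>B. cinner b c = (if b = c then 1 else 0))"

text \<open>For an orthonormal set \<open>B\<close> this is membership in its linear span.\<close>

definition expands_in :: "'h::complex_hilbert_space set \<Rightarrow> 'h \<Rightarrow> bool" where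
  "expands_in B x \<longleftrightarrow> x = (\<Sum>b\<in>B. cinner x b *\<^sub>C b)"

lemma cinner_expansion:
  assumes "orthonormal_set B" "c \<in> B"
  shows "cinner (\<Sum>b\<in>B. f b *\<^sub>C b) c = f c"
proof -
  have "cinner (\<Sum>b\<in>B. f b *\<^sub>C b) c = (\<Sum>b\<in>B. if c = b then f b else 0)"
    unfolding cinner_sum_left
    using assms by (intro sum.cong refl) (simp add: cinner_scaleC_left orthonormal_set_def)
  also have "\<dots> = f c" using assms by (simp add: orthonormal_set_def)
  finally show ?thesis .
qed

lemma Gram_Schmidt_step:
  assumes B: "orthonormal_set B" and x: "\<not> expands_in B x"
  shows "\<exists>e. e \<notin> B \<and> orthonormal_set (insert e B) \<and> expands_in (insert e B) x"
proof -
  define p where "p = (\<Sum>b\<in>B. cinner x b *\<^sub>C b)"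
  define r where "r = x - p"
  have r0: "norm r > 0" using x by (simp add: r_def p_def expands_in_def)
  define e where "e = of_real (1 / norm r) *\<^sub>C r"
  have rb: "cinner r b = 0" if "b \<in> B" for b
    unfolding r_def p_def using cinner_expansion[OF B that] by (simp add: cinner_diff_left)
  have br: "cinner b r = 0" if "b \<in> B" for b
    using rb[OF that] cinner_commute[of b r] by simp
  have eb: "cinner e b = 0" "cinner b e = 0" if "b \<in> B" for b
    using rb[OF that] br[OF that] by (simp_all add: e_def cinner_scaleC_left cinner_scaleC_right)
  have ee: "cinner e e = 1"
    using r0 by (simp add: e_def cinner_scaleC_left cinner_scaleC_right cinner_self[of r] power2_eq_square)
  have eB: "e \<notin> B" using eb ee by fastforce
  have "cinner p e = 0"
    unfolding p_def by (simp add: cinner_sum_left cinner_scaleC_left eb)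
  then have "cinner x e = cinner r e" by (simp add: r_def cinner_diff_left)
  also have "\<dots> = of_real (norm r)"
    using r0 by (simp add: e_def cinner_scaleC_right cinner_self power2_eq_square)
  finally have "cinner x e *\<^sub>C e = (of_real (norm r) * of_real (1 / norm r)) *\<^sub>C r"
    by (simp only: e_def scaleC_scaleC)
  also have "\<dots> = r" using r0 by (simp add: scaleC_one)
  finally have "cinner x e *\<^sub>C e + p = x" by (simp add: r_def)
  then have "expands_in (insert e B) x"
    using B eB unfolding expands_in_def orthonormal_set_def by (simp add: p_def)
  moreover have "orthonormal_set (insert e B)"
    using B ee eb eB by (auto simp: orthonormal_set_def)
  ultimately show ?thesis using eB by blast
qed

lemma expands_in_mono:
  assumes B: "orthonormal_set B" and C: "orthonormal_set C" "B \<subseteq> C" and x: "expands_in B x"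
  shows "expands_in C x"
proof -
  have fin: "finite C" using C by (simp add: orthonormal_set_def)
  have "cinner x c = 0" if c: "c \<in> C - B" for c
  proof -
    have "cinner x c = (\<Sum>b\<in>B. cinner x b * cinner b c)"
      using x unfolding expands_in_def by (metis (no_types, lifting) cinner_sum_left cinner_scaleC_left sum.cong)
    also have "\<dots> = 0"
    proof (intro sum.neutral ballI)
      fix b assume "b \<in> B"
      then have "b \<in> C" "b \<noteq> c" using C(2) c by auto
      then show "cinner x b * cinner b c = 0" using C(1) c by (simp add: orthonormal_set_def)
    qed
    finally show ?thesis .
  qed
  then have "(\<Sum>b\<in>C. cinner x b *\<^sub>C b) = (\<Sum>b\<in>B. cinner x b *\<^sub>C b)"
    using C fin by (intro sum.mono_neutral_right) auto
  then show ?thesis using x by (simp add: expands_in_def)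
qed

lemma orthonormal_basis_of_finite_set:
  assumes "finite E"
  shows "\<exists>B. orthonormal_set B \<and> (\<forall>x\<in>E. expands_in B x)"
  using assms
proof (induction E rule: finite_induct)
  case empty then show ?case by (auto simp: orthonormal_set_def intro!: exI[of _ "{}"])
next
  case (insert x E)
  then obtain B where B: "orthonormal_set B" "\<forall>x\<in>E. expands_in B x" by auto
  show ?case
  proof (cases "expands_in B x")
    case False
    then obtain e where "orthonormal_set (insert e B)" "expands_in (insert e B) x"
      using Gram_Schmidt_step[OF B(1)] by blast
    then show ?thesis using B expands_in_mono[OF B(1)] by (metis insert_iff subset_insertI)
  qed (use B in auto)
qed

lemma orthonormal_set_of_any_size:
  assumes inf: "infinite_dimensional TYPE('h::complex_hilbert_space)"
  shows "\<exists>B :: 'h set. orthonormal_set B \<and> card B = n"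
proof (induction n)
  case 0 then show ?case by (auto simp: orthonormal_set_def intro!: exI[of _ "{}"])
next
  case (Suc n)
  then obtain B :: "'h set" where B: "orthonormal_set B" "card B = n" by auto
  interpret cvec: module "scaleC :: complex \<Rightarrow> 'h \<Rightarrow> 'h" by (rule module_scaleC)
  have fin: "finite B" using B by (simp add: orthonormal_set_def)
  have "\<exists>x. \<not> expands_in B x"
  proof (rule ccontr)
    assume "\<not> ?thesis"
    then have "x \<in> cvec.span B" for x
      unfolding expands_in_def by (metis (no_types, lifting) cvec.span_sum cvec.span_scale cvec.span_base)
    then show False using inf fin by (auto simp: infinite_dimensional_def)
  qed
  then obtain e where "e \<notin> B" "orthonormal_set (insert e B)" using Gram_Schmidt_step[OF B(1)] by blast
  then show ?case using B fin by (intro exI[of _ "insert e B"]) auto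
qed

text \<open>The copies are obtained by transporting the expansion in an orthonormal basis \<open>B\<close> of the span of \<open>E\<close>
  to an orthonormal set indexed by \<open>B \<times> I\<close>; such a set exists because the space is
  infinite-dimensional.\<close>

lemma orthogonal_copies:
  fixes E :: "'h::complex_hilbert_space set"
  assumes inf: "infinite_dimensional TYPE('h)" and E: "finite E" and I: "finite (I :: 'i set)"
  shows "\<exists>V :: 'i \<Rightarrow> 'h \<Rightarrow> 'h. \<forall>i\<in>I. \<forall>j\<in>I. \<forall>x\<in>E. \<forall>y\<in>E.
    cinner (V i x) (V j y) = (if i = j then cinner x y else 0)"
proof -
  obtain B where B: "orthonormal_set B" "\<forall>x\<in>E. expands_in B x"
    using orthonormal_basis_of_finite_set[OF E] by blast
  then have fin: "finite (B \<times> I)" using I by (simp add: orthonormal_set_def)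
  obtain C :: "'h set" where C: "orthonormal_set C" "card C = card (B \<times> I)"
    using orthonormal_set_of_any_size[OF inf] by blast
  then obtain g where g: "bij_betw g (B \<times> I) C"
    using fin finite_same_card_bij[of "B \<times> I" C] by (auto simp: orthonormal_set_def)
  have gg: "cinner (g p) (g q) = (if p = q then 1 else 0)" if "p \<in> B \<times> I" "q \<in> B \<times> I" for p q
  proof -
    have "g p \<in> C" "g q \<in> C" using g that by (auto simp: bij_betw_def)
    moreover have "g p = g q \<longleftrightarrow> p = q" using g that by (meson bij_betw_def inj_on_eq_iff)
    ultimately show ?thesis using C(1) by (simp add: orthonormal_set_def)
  qed
  define V where "V i x = (\<Sum>b\<in>B. cinner x b *\<^sub>C g (b, i))" for i x
  have "cinner (V i x) (V j y) = (if i = j then cinner x y else 0)"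
    if ij: "i \<in> I" "j \<in> I" and xy: "x \<in> E" "y \<in> E" for i j x y
  proof -
    have "cinner (V i x) (V j y)
        = (\<Sum>b\<in>B. \<Sum>c\<in>B. if c = b then (if i = j then cinner x b * cnj (cinner y b) else 0) else 0)"
      unfolding V_def cinner_sum_left cinner_sum_right
      using ij by (intro sum.cong refl) (auto simp: cinner_scaleC_left cinner_scaleC_right gg)
    also have "\<dots> = (\<Sum>b\<in>B. if i = j then cinner x b * cnj (cinner y b) else 0)"
      using B(1) by (simp add: orthonormal_set_def)
    also have "\<dots> = (if i = j then cinner x y else 0)"
    proof -
      have "cinner x y = cinner x (\<Sum>b\<in>B. cinner y b *\<^sub>C b)"
        using B(2) xy by (metis expands_in_def)
      then show ?thesis
        by (simp add: cinner_sum_right cinner_scaleC_right mult.commute)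
    qed
    finally show ?thesis .
  qed
  then show ?thesis by blast
qed


section \<open>Density of unitaries with prescribed asymptotics\<close>

text \<open>Copies \<open>V (j, s) x\<close> with \<open>j < M\<close> form, for every \<open>s\<close>, a tower of height \<open>M\<close>. The unitary \<open>T\<close> moves the
  copy at level \<open>j\<close> down to level \<open>j - 1\<close>, and the copy at level \<open>0\<close>, multiplied by \<open>t s\<close>, back to the
  top; thus \<open>T\<^sup>M\<close> is multiplication by \<open>t s\<close> on tower \<open>s\<close>. The isometry \<open>J\<close> places \<open>u\<^sup>j x\<close>
  at level \<open>j\<close>, with mass \<open>w s / M\<close> in tower \<open>s\<close>. It intertwines \<open>u\<close> with \<open>T\<close> except
  at the top level, which carries only a fraction \<open>1 / M\<close> of the squared norm. On finitely many vectors \<open>J\<close>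
  agrees with a unitary \<open>W\<close>, and \<open>v\<close> is the conjugate of \<open>T\<close> by \<open>W\<close>.\<close>

lemma unitary_twisted_tower_near:
  fixes u :: "'h::complex_hilbert_space \<Rightarrow> 'h" and w :: "'s \<Rightarrow> real" and t :: "'s \<Rightarrow> complex"
  assumes inf: "infinite_dimensional TYPE('h)" and u: "unitary_operator u"
    and E: "finite E" and \<epsilon>: "\<epsilon> > 0" and S: "finite S"
    and w: "\<And>s. s \<in> S \<Longrightarrow> 0 \<le> w s" "sum w S = 1" and t: "\<And>s. s \<in> S \<Longrightarrow> cmod (t s) = 1"
  obtains v M where "unitary_operator v" "M \<ge> 1" "\<And>x. x \<in> E \<Longrightarrow> norm (v x - u x) < \<epsilon>"
    "\<And>k x y. \<lbrakk>x \<in> E; y \<in> E\<rbrakk> \<Longrightarrow>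
      cinner ((v ^^ (k * M)) x) y = (\<Sum>s\<in>S. of_real (w s) * t s ^ k) * cinner x y"
proof -
  obtain C where C: "\<And>x. x \<in> E \<Longrightarrow> norm x \<le> C"
    using finite_imp_bounded[OF E] by (auto simp: bounded_iff)
  (* Each of the card S towers contributes at most 2 * C / sqrt M to norm (v x - u x). *)
  obtain m :: nat where m: "(2 * C * card S / \<epsilon>)\<^sup>2 < real m" using reals_Archimedean2 by blast
  define M where "M = Suc m"
  define E' where "E' = (\<lambda>(j, x). (u ^^ j) x) ` ({..M} \<times> E)"
  have E': "finite E'" using E by (simp add: E'_def)
  have pow_E': "(u ^^ j) x \<in> E'" if "j \<le> M" "x \<in> E" for j x
    unfolding E'_def using that by (intro image_eqI[of _ _ "(j, x)"]) auto
  define I where "I = {..<M} \<times> S"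
  have I: "finite I" using S by (simp add: I_def)
  obtain V :: "nat \<times> 's \<Rightarrow> 'h \<Rightarrow> 'h"
    where V: "\<And>i j x y. \<lbrakk>i \<in> I; j \<in> I; x \<in> E'; y \<in> E'\<rbrakk> \<Longrightarrow>
      cinner (V i x) (V j y) = (if i = j then cinner x y else 0)"
    using orthogonal_copies[OF inf E' I] by metis
  have normV: "norm (V i x) = norm x" if "i \<in> I" "x \<in> E'" for i x
    using V[of i i x x] that by (simp add: norm_eq_sqrt_cinner)

  (* Level and phase after one step of the tower map; the phase occurs only when wrapping around. *)
  define \<tau> where "\<tau> j = (if j = 0 then m else j - 1)" for j :: nat
  define ph where "ph j s = (if j = (0::nat) then t s else 1)" for j s
  have "\<exists>T. unitary_operator T \<and> (\<forall>i\<in>I \<times> E'. T (V (fst i) (snd i)) =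
      ph (fst (fst i)) (snd (fst i)) *\<^sub>C V (\<tau> (fst (fst i)), snd (fst i)) (snd i))"
  proof (rule unitary_extending_same_Gram)
    fix p q assume pq: "p \<in> I \<times> E'" "q \<in> I \<times> E'"
    obtain i r x where p: "p = ((i, r), x)" by (metis surj_pair)
    obtain j s y where q: "q = ((j, s), y)" by (metis surj_pair)
    have I': "(i, r) \<in> I" "(j, s) \<in> I" "(\<tau> i, r) \<in> I" "(\<tau> j, s) \<in> I"
      using pq by (auto simp: p q I_def \<tau>_def M_def)
    have inj: "\<tau> i = \<tau> j \<longleftrightarrow> i = j"
      using pq by (auto simp: p q I_def \<tau>_def M_def split: if_splits)
    have "ph i r * cnj (ph i r) = 1"
      using t[of r] pq by (auto simp: ph_def p I_def complex_norm_square[symmetric])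
    then show "cinner (V (fst p) (snd p)) (V (fst q) (snd q)) =
      cinner (ph (fst (fst p)) (snd (fst p)) *\<^sub>C V (\<tau> (fst (fst p)), snd (fst p)) (snd p))
        (ph (fst (fst q)) (snd (fst q)) *\<^sub>C V (\<tau> (fst (fst q)), snd (fst q)) (snd q))"
      using pq I' V by (auto simp: p q cinner_scaleC_left cinner_scaleC_right inj simp flip: mult.assoc)
        (metis (no_types, lifting) mult.commute mult.left_neutral)
  qed (use I E' in auto)
  then obtain T where T: "unitary_operator T"
    and TV: "\<And>j s x. \<lbrakk>j < M; s \<in> S; x \<in> E'\<rbrakk> \<Longrightarrow> T (V (j, s) x) = ph j s *\<^sub>C V (\<tau> j, s) x"
    by (auto simp: I_def)
  have TV0: "T (V (0, s) x) = t s *\<^sub>C V (m, s) x" if "s \<in> S" "x \<in> E'" for s x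
    using TV[of 0 s x] that by (simp add: M_def ph_def \<tau>_def)
  have TVSuc: "T (V (Suc j, s) x) = V (j, s) x" if "j < m" "s \<in> S" "x \<in> E'" for j s x
    using TV[of "Suc j" s x] that by (simp add: M_def ph_def \<tau>_def scaleC_one)
  note Tscale = unitary_operatorD(2)[OF unitary_funpow[OF T]]
  have down: "(T ^^ i) (V (j + i, s) x) = V (j, s) x" if "j + i \<le> m" "s \<in> S" "x \<in> E'" for i j s x
    using that
  proof (induction i)
    case (Suc i)
    then have "(T ^^ Suc i) (V (j + Suc i, s) x) = (T ^^ i) (V (j + i, s) x)"
      using TVSuc[of "j + i" s x] by (simp add: funpow_Suc_right del: funpow.simps)
    then show ?case using Suc by simp
  qed simp
  have TM: "(T ^^ M) (V (j, s) x) = t s *\<^sub>C V (j, s) x" if j: "j < M" and s: "s \<in> S" and x: "x \<in> E'" for j s x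
  proof -
    have M: "M = (m - j) + (1 + j)" using j by (simp add: M_def)
    have "(T ^^ (1 + j)) (V (j, s) x) = T ((T ^^ j) (V (0 + j, s) x))" by simp
    also have "\<dots> = t s *\<^sub>C V (j + (m - j), s) x"
      using down[of 0 j s x] j s x TV0 by (simp add: M_def)
    finally have "(T ^^ M) (V (j, s) x) = (T ^^ (m - j)) (t s *\<^sub>C V (j + (m - j), s) x)"
      unfolding M funpow_add by simp
    also have "\<dots> = t s *\<^sub>C V (j, s) x"
      using down[of j "m - j" s x] j s x by (simp add: Tscale M_def)
    finally show ?thesis .
  qed
  have TkM: "(T ^^ (k * M)) (V (j, s) x) = t s ^ k *\<^sub>C V (j, s) x"
    if "j < M" "s \<in> S" "x \<in> E'" for k j s x
  proof (induction k)
    case (Suc k)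
    then show ?case using TM[OF that] by (simp add: funpow_add Tscale scaleC_scaleC mult.commute)
  qed (simp add: scaleC_one)

  (* W has to follow J on u ` E as well, since v x is compared with u x. *)
  define F where "F = E \<union> u ` E"
  have EF: "E \<subseteq> F" by (simp add: F_def)
  have pow_F: "(u ^^ j) x \<in> E'" if "j < M" "x \<in> F" for j x
  proof -
    have "(u ^^ j) (u y) \<in> E'" if "y \<in> E" for y
      using pow_E'[of "Suc j" y] \<open>j < M\<close> that by (simp add: funpow_swap1)
    then show ?thesis using that pow_E'[of j x] by (auto simp: F_def)
  qed
  define J where "J \<alpha> x = (\<Sum>s\<in>S. \<Sum>j<M. \<alpha> s *\<^sub>C V (j, s) ((u ^^ j) x))" for \<alpha> x
  have JJ: "cinner (J \<alpha> x) (J \<beta> y) = of_nat M * (\<Sum>s\<in>S. \<alpha> s * cnj (\<beta> s)) * cinner x y"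
    if xy: "x \<in> F" "y \<in> F" for \<alpha> \<beta> x y
  proof -
    have J': "J \<gamma> z = (\<Sum>i\<in>I. \<gamma> (snd i) *\<^sub>C V i ((u ^^ fst i) z))" for \<gamma> z
      unfolding J_def I_def by (subst sum.swap) (simp add: sum.cartesian_product case_prod_unfold)
    have "cinner (J \<alpha> x) (J \<beta> y)
        = (\<Sum>i\<in>I. \<Sum>j\<in>I. if j = i then \<alpha> (snd i) * cnj (\<beta> (snd i)) * cinner x y else 0)"
      unfolding J' unfolding cinner_sum_left unfolding cinner_sum_right
    proof (intro sum.cong refl)
      fix i j assume ij: "i \<in> I" "j \<in> I"
      then have "cinner (V i ((u ^^ fst i) x)) (V j ((u ^^ fst j) y)) = (if j = i then cinner x y else 0)"
        using V[OF ij pow_F[OF _ xy(1)] pow_F[OF _ xy(2)]] unitary_operatorD(3)[OF unitary_funpow[OF u]]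
        by (metis I_def lessThan_iff mem_Times_iff)
      then show "cinner (\<alpha> (snd i) *\<^sub>C V i ((u ^^ fst i) x)) (\<beta> (snd j) *\<^sub>C V j ((u ^^ fst j) y))
          = (if j = i then \<alpha> (snd i) * cnj (\<beta> (snd i)) * cinner x y else 0)"
        by (simp add: cinner_scaleC_left cinner_scaleC_right)
    qed
    also have "\<dots> = (\<Sum>i\<in>I. \<alpha> (snd i) * cnj (\<beta> (snd i)) * cinner x y)" using I by simp
    also have "\<dots> = (\<Sum>j<M. \<Sum>s\<in>S. \<alpha> s * cnj (\<beta> s) * cinner x y)"
      unfolding sum.cartesian_product by (simp add: I_def case_prod_unfold)
    also have "\<dots> = of_nat M * (\<Sum>s\<in>S. \<alpha> s * cnj (\<beta> s)) * cinner x y"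
      by (simp add: sum_distrib_right mult.assoc)
    finally show ?thesis .
  qed
  define \<gamma> where "\<gamma> s = complex_of_real (sqrt (w s) / sqrt (real M))" for s
  have \<gamma>: "of_nat M * (\<gamma> s * cnj (\<gamma> s)) = of_real (w s)" if "s \<in> S" for s
  proof -
    have "\<gamma> s * cnj (\<gamma> s) = of_real ((sqrt (w s) / sqrt (real M)) * (sqrt (w s) / sqrt (real M)))"
      unfolding \<gamma>_def complex_cnj_complex_of_real by (rule of_real_mult[symmetric])
    also have "\<dots> = of_real (w s) / of_nat M"
      using w(1)[OF that] by simp
    finally show ?thesis by (simp add: M_def del: of_nat_Suc)
  qed
  have "cinner x y = cinner (J \<gamma> x) (J \<gamma> y)" if "x \<in> F" "y \<in> F" for x y
    using w(2) by (simp add: JJ[OF that] sum_distrib_left \<gamma> flip: of_real_sum)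
  then obtain W where W: "unitary_operator W" "\<And>x. x \<in> F \<Longrightarrow> W x = J \<gamma> x"
    using unitary_extending_same_Gram[of F "\<lambda>x. x" "J \<gamma>"] E by (auto simp: F_def)
  have WW: "W (inv W z) = z" "inv W (W z) = z" for z
    using unitary_bij[OF W(1)] by (simp_all add: bij_is_surj surj_f_inv_f bij_is_inj)
  note iW = unitary_inv[OF W(1)]
  define v where "v z = inv W (T (W z))" for z
  have v: "unitary_operator v"
    unfolding v_def by (intro unitary_comp[OF iW] unitary_comp[OF T] W(1))
  have vpow: "(v ^^ n) z = inv W ((T ^^ n) (W z))" for n z
    by (induction n) (simp_all add: v_def WW)
  have near: "norm (v x - u x) < \<epsilon>" if x: "x \<in> E" for x
  proof -
    have ux: "u x \<in> F" "x \<in> F" using x by (auto simp: F_def)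
    have xE': "x \<in> E'" "(u ^^ M) x \<in> E'" using pow_E'[of 0 x] pow_E'[of M x] x by simp_all
    have "T (J \<gamma> x) = (\<Sum>s\<in>S. \<Sum>j<M. \<gamma> s *\<^sub>C T (V (j, s) ((u ^^ j) x)))"
      by (simp add: J_def unitary_sum[OF T] unitary_operatorD(2)[OF T])
    also have "\<dots> = (\<Sum>s\<in>S. \<gamma> s *\<^sub>C t s *\<^sub>C V (m, s) x
        + (\<Sum>j<m. \<gamma> s *\<^sub>C V (j, s) ((u ^^ Suc j) x)))"
    proof (intro sum.cong refl)
      fix s assume s: "s \<in> S"
      have "(\<Sum>j<m. \<gamma> s *\<^sub>C T (V (Suc j, s) ((u ^^ Suc j) x))) = (\<Sum>j<m. \<gamma> s *\<^sub>C V (j, s) ((u ^^ Suc j) x))"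
        using TVSuc[OF _ s pow_E'[OF _ x]] by (intro sum.cong refl) (simp add: M_def del: funpow.simps)
      then show "(\<Sum>j<M. \<gamma> s *\<^sub>C T (V (j, s) ((u ^^ j) x))) = \<gamma> s *\<^sub>C t s *\<^sub>C V (m, s) x
          + (\<Sum>j<m. \<gamma> s *\<^sub>C V (j, s) ((u ^^ Suc j) x))"
        using TV0[OF s xE'(1)] unfolding M_def sum.lessThan_Suc_shift by simp
    qed
    finally have TJ: "T (J \<gamma> x) = \<dots>" .
    have "J \<gamma> (u x) = (\<Sum>s\<in>S. \<gamma> s *\<^sub>C V (m, s) ((u ^^ M) x) + (\<Sum>j<m. \<gamma> s *\<^sub>C V (j, s) ((u ^^ Suc j) x)))"
      unfolding J_def M_def by (simp add: funpow_swap1 add.commute)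
    then have "T (J \<gamma> x) - J \<gamma> (u x)
        = (\<Sum>s\<in>S. \<gamma> s *\<^sub>C (t s *\<^sub>C V (m, s) x - V (m, s) ((u ^^ M) x)))"
      unfolding TJ by (simp add: sum_subtractf[symmetric] scaleC_diff_right)
    also have "norm \<dots> \<le> (\<Sum>s\<in>S. 2 * C / sqrt M)"
    proof (rule sum_norm_le)
      fix s assume s: "s \<in> S"
      have mI: "(m, s) \<in> I" using s by (simp add: I_def M_def)
      have "norm (t s *\<^sub>C V (m, s) x - V (m, s) ((u ^^ M) x)) \<le> norm x + norm x"
        using norm_triangle_ineq4[of "t s *\<^sub>C V (m, s) x" "V (m, s) ((u ^^ M) x)"]
        by (simp only: norm_scaleC t[OF s] normV[OF mI xE'(1)] normV[OF mI xE'(2)]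
            unitary_norm[OF unitary_funpow[OF u]] mult_1)
      also have "\<dots> \<le> 2 * C" using C[OF x] by simp
      finally have le: "norm (t s *\<^sub>C V (m, s) x - V (m, s) ((u ^^ M) x)) \<le> 2 * C" .
      have "w s \<le> 1" using member_le_sum[OF s, of w] w S by simp
      then have "cmod (\<gamma> s) \<le> 1 / sqrt M"
        unfolding \<gamma>_def norm_of_real using w(1)[OF s] by (simp add: divide_right_mono)
      then have "cmod (\<gamma> s) * norm (t s *\<^sub>C V (m, s) x - V (m, s) ((u ^^ M) x)) \<le> 1 / sqrt M * (2 * C)"
        using le by (intro mult_mono) auto
      then show "norm (\<gamma> s *\<^sub>C (t s *\<^sub>C V (m, s) x - V (m, s) ((u ^^ M) x))) \<le> 2 * C / sqrt M"
        by (simp add: norm_scaleC)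
    qed
    also have "\<dots> < \<epsilon>"
    proof -
      have "(2 * C * card S / \<epsilon>)\<^sup>2 < real M" using m by (simp add: M_def)
      then have "2 * C * card S / \<epsilon> < sqrt M" by (rule real_less_rsqrt)
      then show ?thesis using \<epsilon> by (simp add: field_simps M_def)
    qed
    finally have "norm (T (J \<gamma> x) - J \<gamma> (u x)) < \<epsilon>" .
    moreover have "v x - u x = inv W (T (J \<gamma> x) - J \<gamma> (u x))"
      unfolding v_def unitary_diff[OF iW] using W(2)[OF ux(1)] W(2)[OF ux(2)] WW by metis
    ultimately show ?thesis by (simp add: unitary_norm[OF iW])
  qed
  have coef: "cinner ((v ^^ (k * M)) x) y = (\<Sum>s\<in>S. of_real (w s) * t s ^ k) * cinner x y"
    if xy: "x \<in> E" "y \<in> E" for k x y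
  proof -
    have F: "x \<in> F" "y \<in> F" using xy by (auto simp: F_def)
    have "cinner ((v ^^ (k * M)) x) y = cinner ((T ^^ (k * M)) (W x)) (W y)"
      unfolding vpow using unitary_operatorD(3)[OF W(1)] WW by metis
    also have "(T ^^ (k * M)) (W x) = J (\<lambda>s. \<gamma> s * t s ^ k) x"
      unfolding W(2)[OF F(1)] J_def unitary_sum[OF unitary_funpow[OF T]] Tscale
      using TkM pow_F F(1) by (intro sum.cong refl) (simp add: scaleC_scaleC)
    also have "cinner \<dots> (W y) = (\<Sum>s\<in>S. of_nat M * (\<gamma> s * cnj (\<gamma> s)) * t s ^ k) * cinner x y"
      unfolding W(2)[OF F(2)] JJ[OF F] by (simp add: sum_distrib_left mult_ac)
    also have "(\<Sum>s\<in>S. of_nat M * (\<gamma> s * cnj (\<gamma> s)) * t s ^ k) = (\<Sum>s\<in>S. of_real (w s) * t s ^ k)"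
      by (simp add: \<gamma>)
    finally show ?thesis .
  qed
  have "M \<ge> 1" by (simp add: M_def)
  then show thesis using that[OF v _ near coef] by blast
qed


section \<open>Weak limits of characters on the circle\<close>

locale circle_measure = finite_measure \<mu> for \<mu> :: "complex measure" +
  assumes sets_circle: "sets \<mu> = sets circle_borel"

lemma circle_measure_iff: "circle_measure \<mu> \<longleftrightarrow> finite_circle_measure \<mu>"
  by (simp add: circle_measure_def circle_measure_axioms_def finite_circle_measure_def)

context circle_measure
begin

lemma space_circle: "space \<mu> = sphere 0 1"
  using sets_eq_imp_space_eq[OF sets_circle] by (simp add: circle_borel_def)

lemma measurable_circle:
  assumes "f \<in> borel_measurable borel" shows "f \<in> borel_measurable \<mu>"
proof -
  have "f \<in> borel_measurable circle_borel"
    unfolding circle_borel_def by (rule measurable_restrict_space1[OF assms])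
  then show ?thesis by (simp cong: measurable_cong_sets add: sets_circle)
qed

lemma integrable_circle:
  fixes f :: "complex \<Rightarrow> 'b::{banach, second_countable_topology}"
  assumes "f \<in> borel_measurable borel" "\<And>z. norm z = 1 \<Longrightarrow> norm (f z) \<le> C"
  shows "integrable \<mu> f"
  using assms by (intro integrable_const_bound[of f C] measurable_circle) (auto simp: space_circle)

end

lemma borel_measurable_powi [measurable]: "(\<lambda>z::complex. z powi m) \<in> borel_measurable borel"
  unfolding power_int_def by measurable

lemma bounded_circle_iff: "bounded (f ` sphere 0 1) \<longleftrightarrow> (\<exists>C. \<forall>z::complex. norm z = 1 \<longrightarrow> norm (f z) \<le> C)"
  by (simp add: bounded_iff sphere_def)

lemma norm_circle_powi: "norm (z::complex) = 1 \<Longrightarrow> norm (z powi m) = 1"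
  by (simp add: norm_power_int)

lemma norm_circle_power: "norm (z::complex) = 1 \<Longrightarrow> norm (z ^ m) = 1"
  by (simp add: norm_power)

text \<open>When this holds for all integrable \<open>f\<close>, the characters \<open>z ^ n j\<close> converge to the constant \<open>c\<close>
  in the weak-star topology of \<open>L\<^sup>\<infinity>\<close> of \<open>\<mu>\<close>.\<close>

definition character_limit :: "complex measure \<Rightarrow> (nat \<Rightarrow> nat) \<Rightarrow> complex \<Rightarrow> (complex \<Rightarrow> complex) \<Rightarrow> bool" where
  "character_limit \<mu> n c f \<longleftrightarrow> (\<lambda>j. LINT z|\<mu>. z ^ n j * f z) \<longlonglongrightarrow> c * (LINT z|\<mu>. f z)"

text \<open>Only trigonometric monomials are tested, so the condition is one on Fourier coefficients; the
  passage to all integrable functions is \<open>character_limit_integrable\<close>.\<close>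

definition weak_multiplier :: "complex measure \<Rightarrow> (nat \<Rightarrow> nat) \<Rightarrow> complex \<Rightarrow> bool" where
  "weak_multiplier \<mu> n c \<longleftrightarrow> (\<forall>m. character_limit \<mu> n c (\<lambda>z. z powi m))"

context circle_measure
begin

lemma integrable_character_mult:
  assumes "integrable \<mu> f" shows "integrable \<mu> (\<lambda>z. z ^ m * f z)"
proof (rule Bochner_Integration.integrable_bound[OF assms])
  have "(\<lambda>z. z ^ m) \<in> borel_measurable \<mu>" by (rule measurable_circle) simp
  then show "(\<lambda>z. z ^ m * f z) \<in> borel_measurable \<mu>" using assms by simp
qed (auto simp: space_circle norm_mult norm_circle_power)

lemma character_limit_cong:
  assumes "\<And>z. norm z = 1 \<Longrightarrow> f z = g z"
  shows "character_limit \<mu> n c f = character_limit \<mu> n c g"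
proof -
  have "(LINT z|\<mu>. f z) = (LINT z|\<mu>. g z)"
    "(LINT z|\<mu>. z ^ m * f z) = (LINT z|\<mu>. z ^ m * g z)" for m
    using assms by (auto intro!: Bochner_Integration.integral_cong simp: space_circle)
  then show ?thesis by (simp add: character_limit_def)
qed

lemma character_limit_add:
  assumes "integrable \<mu> f" "integrable \<mu> g" "character_limit \<mu> n c f" "character_limit \<mu> n c g"
  shows "character_limit \<mu> n c (\<lambda>z. f z + g z)"
  using tendsto_add[OF assms(3,4)[unfolded character_limit_def]] assms(1,2)
  unfolding character_limit_def
  by (simp add: distrib_left integrable_character_mult)

lemma character_limit_scale:
  assumes "character_limit \<mu> n c f"
  shows "character_limit \<mu> n c (\<lambda>z. a * f z)"
proof -
  have "(\<lambda>j. a * (LINT z|\<mu>. z ^ n j * f z)) \<longlonglongrightarrow> a * (c * (LINT z|\<mu>. f z))"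
    using assms unfolding character_limit_def by (rule tendsto_mult_left)
  then show ?thesis
    unfolding character_limit_def by (simp add: mult.left_commute flip: integral_mult_right_zero)
qed

lemma character_limit_sum:
  assumes "finite I" "\<And>i. i \<in> I \<Longrightarrow> integrable \<mu> (f i)" "\<And>i. i \<in> I \<Longrightarrow> character_limit \<mu> n c (f i)"
  shows "character_limit \<mu> n c (\<lambda>z. \<Sum>i\<in>I. f i z)"
  using assms
proof (induction I rule: finite_induct)
  case empty then show ?case by (simp add: character_limit_def)
next
  case (insert i I)
  then show ?case using character_limit_add[of "f i" "\<lambda>z. \<Sum>i\<in>I. f i z"] by auto
qed

text \<open>The characters have modulus \<open>1\<close> on the circle, so the functionals in question are
  bounded on \<open>L\<^sup>1\<close> uniformly in \<open>j\<close>, and the set of good functions is \<open>L\<^sup>1\<close>-closed.\<close>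

lemma character_limit_approx:
  assumes f: "integrable \<mu> f"
    and g: "\<And>\<epsilon>. \<epsilon> > 0 \<Longrightarrow> \<exists>g. integrable \<mu> g \<and> character_limit \<mu> n c g \<and> (LINT z|\<mu>. norm (f z - g z)) \<le> \<epsilon>"
  shows "character_limit \<mu> n c f"
  unfolding character_limit_def
proof (rule LIMSEQ_I)
  fix r :: real assume r: "r > 0"
  define K where "K = 2 + cmod c"
  have K: "K > 0" by (simp add: K_def add_pos_nonneg)
  define \<epsilon> where "\<epsilon> = r / (2 * K)"
  have \<epsilon>: "\<epsilon> > 0" using r K by (simp add: \<epsilon>_def)
  obtain g where g: "integrable \<mu> g" "character_limit \<mu> n c g" "(LINT z|\<mu>. norm (f z - g z)) \<le> \<epsilon>"
    using g[OF \<epsilon>] by blast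
  have fg: "integrable \<mu> (\<lambda>z. f z - g z)" using f g(1) by simp
  have bound: "norm (LINT z|\<mu>. z ^ k * (f z - g z)) \<le> \<epsilon>" for k
  proof -
    have "norm (LINT z|\<mu>. z ^ k * (f z - g z)) \<le> (LINT z|\<mu>. norm (z ^ k * (f z - g z)))"
      by (rule integral_norm_bound)
    also have "\<dots> = (LINT z|\<mu>. norm (f z - g z))"
      by (intro Bochner_Integration.integral_cong) (auto simp: space_circle norm_mult norm_circle_power)
    finally show ?thesis using g(3) by simp
  qed
  (* Writing the last integral with z ^ 0 lets the estimate above apply to it as well. *)
  have split: "(LINT z|\<mu>. z ^ k * f z) - c * (LINT z|\<mu>. f z)
      = ((LINT z|\<mu>. z ^ k * g z) - c * (LINT z|\<mu>. g z))
        + ((LINT z|\<mu>. z ^ k * (f z - g z)) - c * (LINT z|\<mu>. z ^ 0 * (f z - g z)))" for k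
    using f g(1) by (simp add: right_diff_distrib integrable_character_mult)
  obtain N where N: "\<And>j. j \<ge> N \<Longrightarrow> norm ((LINT z|\<mu>. z ^ n j * g z) - c * (LINT z|\<mu>. g z)) < \<epsilon>"
    using LIMSEQ_D[OF g(2)[unfolded character_limit_def] \<epsilon>] by blast
  have "norm ((LINT z|\<mu>. z ^ n j * f z) - c * (LINT z|\<mu>. f z)) < r" if j: "j \<ge> N" for j
  proof -
    have "norm ((LINT z|\<mu>. z ^ n j * f z) - c * (LINT z|\<mu>. f z)) \<le>
        norm ((LINT z|\<mu>. z ^ n j * g z) - c * (LINT z|\<mu>. g z))
        + (norm (LINT z|\<mu>. z ^ n j * (f z - g z)) + norm (c * (LINT z|\<mu>. z ^ 0 * (f z - g z))))"
      unfolding split by (intro order_trans[OF norm_triangle_ineq] add_left_mono norm_triangle_ineq4)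
    also have "\<dots> \<le> \<epsilon> + (\<epsilon> + cmod c * \<epsilon>)"
      unfolding norm_mult[of c] using N[OF j] bound by (intro add_mono mult_left_mono) (auto simp del: power_0)
    also have "\<dots> = K * \<epsilon>" by (simp add: K_def algebra_simps)
    also have "\<dots> = r / 2" using K by (simp add: \<epsilon>_def)
    finally show ?thesis using r by simp
  qed
  then show "\<exists>N. \<forall>j\<ge>N. norm ((LINT z|\<mu>. z ^ n j * f z) - c * (LINT z|\<mu>. f z)) < r" by blast
qed

lemma character_limit_dominated:
  fixes s :: "nat \<Rightarrow> complex \<Rightarrow> complex"
  assumes f: "f \<in> borel_measurable \<mu>" and s: "\<And>i. s i \<in> borel_measurable \<mu>"
    and w: "integrable \<mu> w"
    and lim: "\<And>z. norm z = 1 \<Longrightarrow> (\<lambda>i. s i z) \<longlonglongrightarrow> f z"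
    and bd: "\<And>i z. norm z = 1 \<Longrightarrow> norm (s i z) \<le> w z" and cs: "\<And>i. character_limit \<mu> n c (s i)"
  shows "character_limit \<mu> n c f"
proof (rule character_limit_approx)
  have fw: "norm (f z) \<le> w z" if "norm z = 1" for z
    using tendsto_norm[OF lim[OF that]] bd[OF that] by (intro LIMSEQ_le_const2) auto
  have si: "integrable \<mu> (s i)" for i
    by (intro Bochner_Integration.integrable_bound[OF w s] AE_I2)
      (simp add: space_circle order_trans[OF bd abs_ge_self])
  show fi: "integrable \<mu> f"
    by (intro Bochner_Integration.integrable_bound[OF w f] AE_I2)
      (simp add: space_circle order_trans[OF fw abs_ge_self])
  have "(\<lambda>i. LINT z|\<mu>. norm (f z - s i z)) \<longlonglongrightarrow> (LINT z|\<mu>. 0)"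
  proof (rule integral_dominated_convergence[where w = "\<lambda>z. 2 * w z"])
    show "AE z in \<mu>. (\<lambda>i. norm (f z - s i z)) \<longlonglongrightarrow> 0"
    proof (intro AE_I2)
      fix z assume "z \<in> space \<mu>"
      then have "(\<lambda>i. norm (f z - s i z)) \<longlonglongrightarrow> norm (f z - f z)"
        by (intro tendsto_intros lim) (simp add: space_circle)
      then show "(\<lambda>i. norm (f z - s i z)) \<longlonglongrightarrow> 0" by simp
    qed
    show "AE z in \<mu>. norm (norm (f z - s i z)) \<le> 2 * w z" for i
    proof (intro AE_I2)
      fix z assume "z \<in> space \<mu>"
      then have z: "norm z = 1" by (simp add: space_circle)
      show "norm (norm (f z - s i z)) \<le> 2 * w z"
        using norm_triangle_ineq4[of "f z" "s i z"] fw[OF z] bd[OF z, of i] by simp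
    qed
  qed (use f s w in auto)
  then have *: "(\<lambda>i. LINT z|\<mu>. norm (f z - s i z)) \<longlonglongrightarrow> 0" by simp
  fix \<epsilon> :: real assume "\<epsilon> > 0"
  from LIMSEQ_D[OF * this] obtain i where "norm ((LINT z|\<mu>. norm (f z - s i z)) - 0) < \<epsilon>" by blast
  then show "\<exists>g. integrable \<mu> g \<and> character_limit \<mu> n c g \<and> (LINT z|\<mu>. norm (f z - g z)) \<le> \<epsilon>"
    using si[of i] cs[of i] by (intro exI[of _ "s i"]) auto
qed

lemma real_polynomial_on_circle:
  fixes g :: "complex \<Rightarrow> real"
  assumes g: "real_polynomial_function g"
  shows "g \<in> borel_measurable borel" and "\<exists>D. \<forall>z. norm z = 1 \<longrightarrow> \<bar>g z\<bar> \<le> D"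
proof -
  have cont: "continuous_on S g" for S
    using g by (intro continuous_on_polymonial_function) (simp add: real_polynomial_function_eq)
  show "g \<in> borel_measurable borel" by (rule borel_measurable_continuous_onI[OF cont])
  have "bounded (g ` sphere 0 1)"
    by (intro compact_imp_bounded compact_continuous_image cont compact_sphere)
  then show "\<exists>D. \<forall>z. norm z = 1 \<longrightarrow> \<bar>g z\<bar> \<le> D" by (simp add: bounded_circle_iff)
qed

text \<open>The extra factor \<open>f\<close> makes the induction work for products. A linear function is
  \<open>\<alpha> z + cnj \<alpha> / z\<close> on the circle, so multiplying by it only shifts the exponent \<open>m\<close>.\<close>

lemma character_limit_real_polynomial:
  fixes f :: "complex \<Rightarrow> complex"
  assumes "real_polynomial_function g" "f \<in> borel_measurable borel" "bounded (f ` sphere 0 1)"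
    and "\<And>m. character_limit \<mu> n c (\<lambda>z. z powi m * f z)"
  shows "character_limit \<mu> n c (\<lambda>z. z powi m * (f z * of_real (g z)))"
  using assms
proof (induction g arbitrary: f m rule: real_polynomial_function.induct)
  case (linear g)
  interpret g: bounded_linear g by fact
  define \<alpha> where "\<alpha> = (of_real (g 1) - \<i> * of_real (g \<i>)) / 2"
  have int: "integrable \<mu> (\<lambda>z. z powi k * f z)" for k
  proof -
    obtain C where "\<And>z. norm z = 1 \<Longrightarrow> norm (f z) \<le> C"
      using linear(3) by (force simp: bounded_circle_iff)
    then show ?thesis
      using linear(2) by (intro integrable_circle[where C = C]) (auto simp: norm_mult norm_circle_powi)
  qed
  have gz: "of_real (g z) = \<alpha> * z + cnj \<alpha> * cnj z" for z
  proof -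
    have "g z = g (Re z *\<^sub>R 1 + Im z *\<^sub>R \<i>)"
      by (rule arg_cong[of _ _ g]) (simp add: complex_eq_iff)
    also have "\<dots> = Re z * g 1 + Im z * g \<i>" by (simp add: g.add g.scaleR)
    finally show ?thesis by (simp add: \<alpha>_def complex_eq_iff field_simps)
  qed
  have "character_limit \<mu> n c (\<lambda>z. \<alpha> * (z powi (m + 1) * f z) + cnj \<alpha> * (z powi (m - 1) * f z))"
    by (intro character_limit_add character_limit_scale linear integrable_mult_right int)
  also have "?this \<longleftrightarrow> character_limit \<mu> n c (\<lambda>z. z powi m * (f z * of_real (g z)))"
  proof (rule character_limit_cong)
    fix z :: complex assume z: "norm z = 1"
    then have z0: "z \<noteq> 0" by auto
    have "cnj z = inverse z" using z by (simp add: inverse_complex_def complex_eq_iff norm_complex_def)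
    then show "\<alpha> * (z powi (m + 1) * f z) + cnj \<alpha> * (z powi (m - 1) * f z) = z powi m * (f z * of_real (g z))"
      using z0 unfolding gz by (simp add: power_int_add power_int_diff field_simps)
  qed
  finally show ?case .
next
  case (const a)
  then show ?case using character_limit_scale[of n c "\<lambda>z. z powi m * f z" "of_real a"] by (simp add: mult_ac)
next
  case (add g h)
  have "integrable \<mu> (\<lambda>z. z powi m * (f z * of_real (g z)))" if g: "real_polynomial_function g" for g
  proof -
    note gm = real_polynomial_on_circle(1)[OF g]
    obtain D where D: "\<And>z. norm z = 1 \<Longrightarrow> \<bar>g z\<bar> \<le> D" using real_polynomial_on_circle(2)[OF g] by blast
    obtain C where C: "\<And>z. norm z = 1 \<Longrightarrow> norm (f z) \<le> C"
      using add.prems by (force simp: bounded_circle_iff)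
    show ?thesis
    proof (rule integrable_circle[where C = "C * D"])
      fix z :: complex assume z: "norm z = 1"
      have "norm (f z) * \<bar>g z\<bar> \<le> C * D"
        by (intro mult_mono C[OF z] D[OF z] order_trans[OF norm_ge_zero C[OF z]] abs_ge_zero)
      then show "norm (z powi m * (f z * of_real (g z))) \<le> C * D"
        by (simp add: norm_mult norm_circle_powi z)
    qed (use gm add.prems in measurable)
  qed
  then show ?case
    using character_limit_add[of "\<lambda>z. z powi m * (f z * of_real (g z))" "\<lambda>z. z powi m * (f z * of_real (h z))" n c]
      add by (simp add: distrib_left)
next
  case (mult g h)
  note gm = real_polynomial_on_circle(1)[OF mult(1)]
  obtain D where D: "\<And>z. norm z = 1 \<Longrightarrow> \<bar>g z\<bar> \<le> D" using real_polynomial_on_circle(2)[OF mult(1)] by blast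
  obtain C where C: "\<And>z. norm z = 1 \<Longrightarrow> norm (f z) \<le> C"
    using mult.prems by (force simp: bounded_circle_iff)
  have "norm (f z * of_real (g z)) \<le> C * D" if z: "norm z = 1" for z
    unfolding norm_mult norm_of_real
    by (intro mult_mono C[OF z] D[OF z] order_trans[OF norm_ge_zero C[OF z]] abs_ge_zero)
  then have "bounded ((\<lambda>z. f z * of_real (g z)) ` sphere 0 1)"
    by (auto simp: bounded_circle_iff)
  moreover have "(\<lambda>z. f z * of_real (g z)) \<in> borel_measurable borel" using gm mult.prems by measurable
  ultimately have "character_limit \<mu> n c (\<lambda>z. z powi m * ((f z * of_real (g z)) * of_real (h z)))"
    using mult.IH(1)[OF mult.prems] by (intro mult.IH(2)) auto
  then show ?case by (simp add: mult.assoc)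
qed

end

locale weak_multiplier_circle = circle_measure +
  fixes n :: "nat \<Rightarrow> nat" and c :: complex
  assumes weak_multiplier: "weak_multiplier \<mu> n c"
begin

text \<open>By the Weierstrass theorem and \<open>L\<^sup>1\<close>-closedness.\<close>

lemma character_limit_continuous:
  fixes f :: "complex \<Rightarrow> real"
  assumes f: "continuous_on UNIV f"
  shows "character_limit \<mu> n c (\<lambda>z. of_real (f z))"
proof (rule character_limit_approx)
  have int: "integrable \<mu> (\<lambda>z. complex_of_real (g z))" if "continuous_on UNIV g" for g
  proof -
    have "bounded (g ` sphere 0 1)"
      using that by (intro compact_imp_bounded compact_continuous_image) (auto intro: continuous_on_subset)
    then obtain C where "\<And>z. norm z = 1 \<Longrightarrow> \<bar>g z\<bar> \<le> C" by (force simp: bounded_circle_iff)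
    moreover have "g \<in> borel_measurable borel" using that by (rule borel_measurable_continuous_onI)
    ultimately show ?thesis by (intro integrable_circle[where C = C]) auto
  qed
  show fi: "integrable \<mu> (\<lambda>z. complex_of_real (f z))" using int f by blast
  fix \<epsilon> :: real assume \<epsilon>: "\<epsilon> > 0"
  define K where "K = measure \<mu> (space \<mu>) + 1"
  have K: "K > 0" by (simp add: K_def add_nonneg_pos)
  obtain g where g: "real_polynomial_function g" "\<And>z. z \<in> sphere 0 1 \<Longrightarrow> \<bar>f z - g z\<bar> < \<epsilon> / K"
    using Stone_Weierstrass_real_polynomial_function[of "sphere 0 1" f "\<epsilon> / K"] f \<epsilon> K
    by (metis compact_sphere continuous_on_subset subset_UNIV divide_pos_pos)
  have gc: "continuous_on UNIV g"
    using g(1) by (intro continuous_on_polymonial_function) (simp add: real_polynomial_function_eq)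
  have "character_limit \<mu> n c (\<lambda>z. z powi 0 * (1 * of_real (g z)))"
    using weak_multiplier g(1)
    by (intro character_limit_real_polynomial) (auto simp: weak_multiplier_def bounded_circle_iff intro!: exI[of _ 1])
  then have cg: "character_limit \<mu> n c (\<lambda>z. of_real (g z))" by simp
  have "(LINT z|\<mu>. norm (complex_of_real (f z) - of_real (g z))) \<le> (LINT z|\<mu>. \<epsilon> / K)"
  proof (rule integral_mono)
    show "integrable \<mu> (\<lambda>z. norm (complex_of_real (f z) - of_real (g z)))"
      using int[OF f] int[OF gc] by (intro integrable_norm Bochner_Integration.integrable_diff)
    show "norm (complex_of_real (f z) - of_real (g z)) \<le> \<epsilon> / K" if "z \<in> space \<mu>" for z
      using g(2)[of z] that unfolding of_real_diff[symmetric] norm_of_real by (simp add: space_circle)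
  qed simp
  also have "\<dots> = measure \<mu> (space \<mu>) / K * \<epsilon>" by simp
  also have "\<dots> \<le> 1 * \<epsilon>" using K \<epsilon> by (intro mult_right_mono) (auto simp: K_def)
  finally show "\<exists>g. integrable \<mu> g \<and> character_limit \<mu> n c g \<and> (LINT z|\<mu>. norm (complex_of_real (f z) - g z)) \<le> \<epsilon>"
    using cg int[OF gc] by (intro exI[of _ "\<lambda>z. of_real (g z)"]) auto
qed

text \<open>The indicator of an open set is the pointwise limit of the continuous functions
  \<open>min 1 (i * infdist z (- U))\<close>.\<close>

lemma character_limit_open:
  assumes U: "open U"
  shows "character_limit \<mu> n c (indicator U)"
proof (cases "U = UNIV")
  case True
  then show ?thesis using character_limit_continuous[of "\<lambda>_. 1"] by (simp add: indicator_def[abs_def])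
next
  case False
  define s :: "nat \<Rightarrow> complex \<Rightarrow> complex" where "s i z = of_real (min 1 (real i * infdist z (- U)))" for i z
  have lim: "(\<lambda>i. s i z) \<longlonglongrightarrow> indicator U z" for z
  proof (cases "z \<in> U")
    case True
    then have d: "infdist z (- U) > 0"
      using U False by (metis Compl_iff closed_Compl in_closed_iff_infdist_zero infdist_nonneg Compl_UNIV_eq
          double_complement le_less)
    then obtain N where "1 / infdist z (- U) < real N" using reals_Archimedean2 by blast
    then have N: "1 \<le> real N * infdist z (- U)" using d by (simp add: field_simps)
    have "s i z = 1" if "i \<ge> N" for i
    proof -
      have "real N * infdist z (- U) \<le> real i * infdist z (- U)" using that d by (intro mult_right_mono) auto
      then show ?thesis using N by (simp add: s_def)
    qed
    then have "\<forall>\<^sub>F i in sequentially. s i z = indicator U z"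
      using True by (auto simp: eventually_sequentially)
    then show ?thesis by (rule tendsto_eventually)
  next
    case False
    then show ?thesis by (simp add: s_def infdist_zero)
  qed
  have cont: "continuous_on UNIV (\<lambda>z. min 1 (real i * infdist z (- U)))" for i
    by (intro continuous_intros)
  show ?thesis
  proof (rule character_limit_dominated[where w = "\<lambda>_. 1" and s = s])
    show "indicator U \<in> borel_measurable \<mu>" using U by (intro measurable_circle) auto
    show "s i \<in> borel_measurable \<mu>" for i
      unfolding s_def by (intro measurable_circle borel_measurable_continuous_onI continuous_on_of_real cont)
    show "character_limit \<mu> n c (s i)" for i
      unfolding s_def by (rule character_limit_continuous[OF cont])
    show "norm (s i z) \<le> 1" for i z
      unfolding s_def norm_of_real by (simp add: infdist_nonneg)
  qed (use lim in auto)
qed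

text \<open>The open sets form an intersection-stable generator, and the sets whose indicators are good form a
  Dynkin system.\<close>

lemma character_limit_borel:
  assumes "A \<in> sets borel"
  shows "character_limit \<mu> n c (indicator A)"
proof -
  have "Int_stable {S::complex set. open S}" by (auto simp: Int_stable_def)
  moreover have "{S::complex set. open S} \<subseteq> Pow UNIV" by simp
  moreover have "A \<in> sigma_sets UNIV {S. open S}" using assms by (simp add: borel_def)
  ultimately show ?thesis
  proof (induction A rule: sigma_sets_induct_disjoint)
    case (basic A) then show ?case using character_limit_open by simp
  next
    case empty show ?case by (rule character_limit_open) simp
  next
    case (compl A)
    then have [measurable]: "A \<in> sets borel" by (simp add: borel_def)
    have int: "integrable \<mu> (indicator A :: _ \<Rightarrow> complex)" "integrable \<mu> (indicator UNIV :: _ \<Rightarrow> complex)"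
      by (auto intro!: integrable_circle[where C = 1] simp: indicator_def)
    have "character_limit \<mu> n c (\<lambda>z. indicator UNIV z + (- 1) * indicator A z)"
      using compl character_limit_open[of UNIV] int
      by (intro character_limit_add character_limit_scale) auto
    also have "(\<lambda>z. indicator UNIV z + (- 1) * indicator A z :: complex) = indicator (UNIV - A)"
      by (auto simp: indicator_def)
    finally show ?case .
  next
    case (union A)
    then have [measurable]: "A i \<in> sets borel" for i by (auto simp: borel_def)
    have disj: "(\<Sum>i<k. indicator (A i) z :: complex) = indicator (\<Union>i<k. A i) z" for k z
      using union(1) by (intro indicator_UN_disjoint[symmetric]) (auto intro: disjoint_family_on_mono)
    show ?case
    proof (rule character_limit_dominated[where w = "\<lambda>_. 1" and s = "\<lambda>k z. \<Sum>i<k. indicator (A i) z"])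
      show "indicator (\<Union> (range A)) \<in> borel_measurable \<mu>" by (intro measurable_circle) auto
      show "(\<lambda>z. \<Sum>i<k. indicator (A i) z :: complex) \<in> borel_measurable \<mu>" for k
        by (intro measurable_circle borel_measurable_sum borel_measurable_indicator) auto
      show "(\<lambda>k. \<Sum>i<k. indicator (A i) z :: complex) \<longlonglongrightarrow> indicator (\<Union> (range A)) z" for z
        unfolding disj by (rule LIMSEQ_indicator_UN)
      show "norm (\<Sum>i<k. indicator (A i) z :: complex) \<le> 1" for k z
        unfolding disj by (simp add: indicator_def)
      show "character_limit \<mu> n c (\<lambda>z. \<Sum>i<k. indicator (A i) z)" for k
        using union by (intro character_limit_sum integrable_circle[where C = 1]) (auto simp: indicator_def)
    qed simp
  qed
qed

lemma character_limit_integrable: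
  assumes "integrable \<mu> f"
  shows "character_limit \<mu> n c f"
  using assms
proof (induction f rule: integrable_induct)
  case (base A a)
  obtain B where B: "B \<in> sets borel" "A = sphere 0 1 \<inter> B"
    using base(1) by (auto simp: sets_circle circle_borel_def sets_restrict_space)
  have "character_limit \<mu> n c (\<lambda>z. a * indicator B z)"
    by (rule character_limit_scale[OF character_limit_borel[OF B(1)]])
  also have "?this \<longleftrightarrow> character_limit \<mu> n c (\<lambda>z. indicator A z *\<^sub>R a)"
    by (rule character_limit_cong) (auto simp: B(2) indicator_def)
  finally show ?case .
next
  case (add f g)
  then show ?case by (intro character_limit_add)
next
  case (lim f s)
  show ?case
  proof (rule character_limit_dominated)
    show "f \<in> borel_measurable \<mu>" "s i \<in> borel_measurable \<mu>" for i using lim by auto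
    show "integrable \<mu> (\<lambda>z. 2 * norm (f z))" using lim by simp
  qed (use lim in \<open>auto simp: space_circle\<close>)
qed

end


section \<open>Absolutely continuous measures, convolutions, singularity\<close>

lemma finite_density_obtains:
  assumes M: "finite_measure M" and N: "finite_measure N" "sets N = sets M" and ac: "absolutely_continuous M N"
  obtains D :: "_ \<Rightarrow> real" where "D \<in> borel_measurable M" "\<And>x. 0 \<le> D x" "N = density M (\<lambda>x. ennreal (D x))"
proof -
  interpret finite_measure M by fact
  obtain D where D: "D \<in> borel_measurable M" "AE x in M. RN_deriv M N x = ennreal (D x)" "\<And>x. 0 \<le> D x"
    using real_RN_deriv[OF N(1) ac N(2)] by blast
  have "N = density M (RN_deriv M N)" using density_RN_deriv[OF ac N(2)] by simp
  also have "\<dots> = density M (\<lambda>x. ennreal (D x))" using D by (intro density_cong) auto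
  finally show thesis using that D by blast
qed

text \<open>A density \<open>D\<close> is absorbed into the test function: \<open>D f\<close> is integrable with respect to
  \<open>\<mu>\<close>.\<close>

lemma (in weak_multiplier_circle) character_limit_density:
  assumes \<sigma>: "circle_measure \<sigma>" "\<sigma> = density \<mu> (\<lambda>x. ennreal (D x))"
    and D: "D \<in> borel_measurable \<mu>" "\<And>x. 0 \<le> D x" and f: "integrable \<sigma> f"
  shows "character_limit \<sigma> n c f"
proof -
  have fm: "f \<in> borel_measurable \<mu>"
    using borel_measurable_integrable[OF f] by (simp add: \<sigma>(2))
  have eq: "(LINT z|\<sigma>. g z) = (LINT z|\<mu>. D z *\<^sub>R g z)" if "g \<in> borel_measurable \<mu>" for g :: "complex \<Rightarrow> complex"
    unfolding \<sigma>(2) using D that by (intro integral_density) auto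
  have "(\<lambda>z. z ^ k * f z) \<in> borel_measurable \<mu>" for k
    using measurable_circle[of "\<lambda>z. z ^ k"] fm by simp
  moreover have "integrable \<mu> (\<lambda>z. D z *\<^sub>R f z)"
    using f D fm by (simp add: \<sigma>(2) integrable_density)
  ultimately show ?thesis
    using character_limit_integrable[of "\<lambda>z. D z *\<^sub>R f z"] fm
    by (simp add: character_limit_def eq)
qed

lemma weak_multiplier_absolutely_continuous:
  assumes \<mu>: "circle_measure \<mu>" "weak_multiplier \<mu> n c" and \<sigma>: "circle_measure \<sigma>"
    and ac: "absolutely_continuous \<mu> \<sigma>"
  shows "weak_multiplier \<sigma> n c"
proof -
  interpret m: weak_multiplier_circle \<mu> n c
    using \<mu> by (simp add: weak_multiplier_circle_def weak_multiplier_circle_axioms_def)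
  interpret s: circle_measure \<sigma> by fact
  obtain D where "D \<in> borel_measurable \<mu>" "\<And>x. 0 \<le> D x" "\<sigma> = density \<mu> (\<lambda>x. ennreal (D x))"
    using finite_density_obtains[OF m.finite_measure_axioms s.finite_measure_axioms _ ac]
    by (metis m.sets_circle s.sets_circle)
  moreover have "integrable \<sigma> (\<lambda>z. z powi k)" for k
    by (rule s.integrable_circle[where C = 1]) (auto simp: norm_circle_powi)
  ultimately show ?thesis
    unfolding weak_multiplier_def using m.character_limit_density[OF \<sigma>] by blast
qed

lemma circle_measure_convolution:
  assumes \<mu>: "circle_measure \<mu>" and \<nu>: "circle_measure \<nu>"
  shows "circle_measure (circle_convolution \<mu> \<nu>)"
    and "(LINT z|circle_convolution \<mu> \<nu>. z powi k) = (LINT z|\<mu>. z powi k) * (LINT z|\<nu>. z powi k)"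
proof -
  interpret m: circle_measure \<mu> by fact
  interpret v: circle_measure \<nu> by fact
  interpret p: pair_sigma_finite \<mu> \<nu> ..
  have meas: "(\<lambda>(z, w). z * w) \<in> measurable (\<mu> \<Otimes>\<^sub>M \<nu>) circle_borel"
    unfolding circle_borel_def
  proof (rule measurable_restrict_space2)
    have [measurable]: "(\<lambda>z. z) \<in> borel_measurable \<mu>" "(\<lambda>z. z) \<in> borel_measurable \<nu>"
      by (auto intro: m.measurable_circle v.measurable_circle)
    have "fst \<in> borel_measurable (\<mu> \<Otimes>\<^sub>M \<nu>)" "snd \<in> borel_measurable (\<mu> \<Otimes>\<^sub>M \<nu>)"
      using measurable_compose[OF measurable_fst, of "\<lambda>z. z" \<mu> borel \<nu>]
        measurable_compose[OF measurable_snd, of "\<lambda>z. z" \<nu> borel \<mu>] by (simp_all add: comp_def)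
    then show "(\<lambda>(z, w). z * w) \<in> borel_measurable (\<mu> \<Otimes>\<^sub>M \<nu>)"
      by (simp add: case_prod_unfold)
  qed (auto simp: space_pair_measure m.space_circle v.space_circle norm_mult)
  have "emeasure (\<mu> \<Otimes>\<^sub>M \<nu>) (space \<mu> \<times> space \<nu>) = emeasure \<mu> (space \<mu>) * emeasure \<nu> (space \<nu>)"
    by (rule v.emeasure_pair_measure_Times) auto
  also have "\<dots> < top"
    unfolding less_top[symmetric] by (simp add: ennreal_mult_eq_top_iff)
  finally have "finite_measure (\<mu> \<Otimes>\<^sub>M \<nu>)" by (intro finite_measureI) (simp add: space_pair_measure)
  then have fin: "finite_measure (circle_convolution \<mu> \<nu>)" "finite_measure (\<mu> \<Otimes>\<^sub>M \<nu>)"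
    unfolding circle_convolution_def by (auto intro: finite_measure.finite_measure_distr[OF _ meas])
  then show "circle_measure (circle_convolution \<mu> \<nu>)"
    by (simp add: circle_measure_iff finite_circle_measure_def circle_convolution_def)
  have powm: "(\<lambda>z. z powi k) \<in> borel_measurable circle_borel"
    unfolding circle_borel_def by (intro measurable_restrict_space1) simp
  have meas2: "(\<lambda>q. (fst q * snd q) powi k) \<in> borel_measurable (\<mu> \<Otimes>\<^sub>M \<nu>)"
    using measurable_compose[OF meas powm] by (simp add: case_prod_unfold)
  have int: "integrable (\<mu> \<Otimes>\<^sub>M \<nu>) (\<lambda>q. (fst q * snd q) powi k)"
    using meas2 by (intro finite_measure.integrable_const_bound[OF fin(2), where B = 1])
      (auto simp: space_pair_measure m.space_circle v.space_circle norm_power_int norm_mult)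
  have "(LINT z|circle_convolution \<mu> \<nu>. z powi k) = (LINT q|(\<mu> \<Otimes>\<^sub>M \<nu>). (fst q * snd q) powi k)"
    unfolding circle_convolution_def by (subst integral_distr[OF meas powm]) (simp add: case_prod_unfold)
  also have "\<dots> = (LINT z|\<mu>. LINT w|\<nu>. (z * w) powi k)"
    using p.integral_fst'[OF int] by simp
  also have "\<dots> = (LINT z|\<mu>. z powi k * (LINT w|\<nu>. w powi k))"
    by (simp add: power_int_mult_distrib)
  also have "\<dots> = (LINT z|\<mu>. z powi k) * (LINT z|\<nu>. z powi k)" by simp
  finally show "(LINT z|circle_convolution \<mu> \<nu>. z powi k) = (LINT z|\<mu>. z powi k) * (LINT z|\<nu>. z powi k)" .
qed

lemma weak_multiplier_iff_Fourier:
  assumes "circle_measure \<mu>"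
  shows "weak_multiplier \<mu> n c \<longleftrightarrow>
    (\<forall>m. (\<lambda>j. LINT z|\<mu>. z powi (int (n j) + m)) \<longlonglongrightarrow> c * (LINT z|\<mu>. z powi m))"
proof -
  interpret circle_measure \<mu> by fact
  have "(LINT z|\<mu>. z ^ k * z powi m) = (LINT z|\<mu>. z powi (int k + m))" for k m
  proof (intro Bochner_Integration.integral_cong refl)
    fix z assume "z \<in> space \<mu>"
    then have "z \<noteq> 0" by (auto simp: space_circle)
    then show "z ^ k * z powi m = z powi (int k + m)" by (simp add: power_int_add)
  qed
  then show ?thesis by (simp add: weak_multiplier_def character_limit_def)
qed

lemma weak_multiplier_convolution:
  assumes "circle_measure \<mu>" "circle_measure \<nu>" "weak_multiplier \<mu> n c" "weak_multiplier \<nu> n d"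
  shows "weak_multiplier (circle_convolution \<mu> \<nu>) n (c * d)"
  unfolding weak_multiplier_iff_Fourier[OF circle_measure_convolution(1)[OF assms(1,2)]]
    circle_measure_convolution(2)[OF assms(1,2)]
proof
  fix m
  have "(\<lambda>j. (LINT z|\<mu>. z powi (int (n j) + m)) * (LINT z|\<nu>. z powi (int (n j) + m)))
     \<longlonglongrightarrow> (c * (LINT z|\<mu>. z powi m)) * (d * (LINT z|\<nu>. z powi m))"
    using assms(3,4) unfolding weak_multiplier_iff_Fourier[OF assms(1)] weak_multiplier_iff_Fourier[OF assms(2)]
    by (intro tendsto_mult) auto
  then show "(\<lambda>j. (LINT z|\<mu>. z powi (int (n j) + m)) * (LINT z|\<nu>. z powi (int (n j) + m)))
     \<longlonglongrightarrow> c * d * ((LINT z|\<mu>. z powi m) * (LINT z|\<nu>. z powi m))"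
    by (simp add: mult_ac)
qed

lemma weak_multiplier_convolutions:
  assumes "ks \<noteq> []" "\<And>k. k \<in> set ks \<Longrightarrow> circle_measure (\<sigma> k)" "\<And>k. k \<in> set ks \<Longrightarrow> weak_multiplier (\<sigma> k) n (c k)"
  shows "circle_measure (circle_convolutions (map \<sigma> ks)) \<and>
    weak_multiplier (circle_convolutions (map \<sigma> ks)) n (\<Prod>k\<leftarrow>ks. c k)"
  using assms
proof (induction ks rule: rev_nonempty_induct)
  case (single k) then show ?case by (simp add: circle_convolutions_def)
next
  case (snoc k ks)
  have "circle_convolutions (map \<sigma> (ks @ [k])) = circle_convolution (circle_convolutions (map \<sigma> ks)) (\<sigma> k)"
    using snoc(1) by (cases ks) (simp_all add: circle_convolutions_def)
  then show ?case
    using snoc by (simp add: weak_multiplier_convolution circle_measure_convolution)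
qed

text \<open>Let \<open>f\<close> and \<open>g\<close> be the densities of the two measures with respect to their sum \<open>\<rho>\<close>. Testing the characters
  against \<open>f g\<close>, divided by \<open>(1 + f) (1 + g)\<close> to make it bounded, gives one limit that equals both \<open>c\<close> and
  \<open>d\<close> times the integral. So \<open>f g\<close> vanishes almost everywhere, and the zero set of \<open>f\<close> separates the
  measures.\<close>

lemma mutually_singular_if_weak_multipliers_differ:
  assumes \<mu>: "circle_measure \<mu>" "weak_multiplier \<mu> n c" and \<nu>: "circle_measure \<nu>" "weak_multiplier \<nu> n d"
    and cd: "c \<noteq> d"
  shows "mutually_singular \<mu> \<nu>"
proof -
  interpret m: weak_multiplier_circle \<mu> n c
    using \<mu> by (simp add: weak_multiplier_circle_def weak_multiplier_circle_axioms_def)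
  interpret v: weak_multiplier_circle \<nu> n d
    using \<nu> by (simp add: weak_multiplier_circle_def weak_multiplier_circle_axioms_def)
  have sets: "sets \<nu> = sets \<mu>" by (simp add: m.sets_circle v.sets_circle)
  define \<rho> where "\<rho> = measure_of (space \<mu>) (sets \<mu>) (\<lambda>A. emeasure \<mu> A + emeasure \<nu> A)"
  have sets_\<rho>: "sets \<rho> = sets \<mu>" by (simp add: \<rho>_def)
  have space_\<rho>: "space \<rho> = space \<mu>" by (simp add: \<rho>_def)
  have em: "emeasure \<rho> A = emeasure \<mu> A + emeasure \<nu> A" if "A \<in> sets \<mu>" for A
    unfolding \<rho>_def
  proof (rule emeasure_measure_of_sigma)
    show "sigma_algebra (space \<mu>) (sets \<mu>)" by (rule sets.sigma_algebra_axioms)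
    show "positive (sets \<mu>) (\<lambda>A. emeasure \<mu> A + emeasure \<nu> A)" by (simp add: positive_def)
    show "countably_additive (sets \<mu>) (\<lambda>A. emeasure \<mu> A + emeasure \<nu> A)"
    proof (rule countably_additiveI)
      fix A :: "nat \<Rightarrow> complex set" assume "range A \<subseteq> sets \<mu>" "disjoint_family A"
      then show "(\<Sum>i. emeasure \<mu> (A i) + emeasure \<nu> (A i)) = emeasure \<mu> (\<Union> (range A)) + emeasure \<nu> (\<Union> (range A))"
        using suminf_emeasure[of A \<mu>] suminf_emeasure[of A \<nu>] by (simp add: sets suminf_add[symmetric])
    qed
  qed fact
  interpret r: circle_measure \<rho>
  proof (unfold circle_measure_iff finite_circle_measure_def, intro conjI finite_measureI)
    show "emeasure \<rho> (space \<rho>) \<noteq> \<infinity>"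
      using m.emeasure_finite v.emeasure_finite by (simp add: space_\<rho> em)
  qed (simp add: sets_\<rho> m.sets_circle)
  have ac: "absolutely_continuous \<rho> \<mu>" "absolutely_continuous \<rho> \<nu>"
    unfolding absolutely_continuous_def using sets_\<rho> em by (auto simp: null_sets_def sets)
  obtain f where f: "f \<in> borel_measurable \<rho>" "\<And>x. 0 \<le> f x" "\<mu> = density \<rho> (\<lambda>x. ennreal (f x))"
    using finite_density_obtains[OF r.finite_measure_axioms m.finite_measure_axioms _ ac(1)] sets_\<rho> by auto
  obtain g where g: "g \<in> borel_measurable \<rho>" "\<And>x. 0 \<le> g x" "\<nu> = density \<rho> (\<lambda>x. ennreal (g x))"
    using finite_density_obtains[OF r.finite_measure_axioms v.finite_measure_axioms _ ac(2)] sets sets_\<rho> by auto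
  note [measurable] = f(1) g(1)
  define q where "q x = (1 + f x) * (1 + g x)" for x
  have q: "q x \<ge> 1" "f x \<le> q x" "g x \<le> q x" for x
    using f(2)[of x] g(2)[of x] by (simp_all add: q_def algebra_simps)
  have qpos: "q x > 0" for x using q(1)[of x] by simp
  define h where "h x = f x * g x / q x" for x
  have [measurable]: "q \<in> borel_measurable \<rho>" "h \<in> borel_measurable \<rho>"
    unfolding q_def[abs_def] h_def[abs_def] by measurable
  have int_h: "integrable \<rho> (\<lambda>x. complex_of_real (h x))"
  proof (rule r.integrable_const_bound)
    show "AE x in \<rho>. norm (complex_of_real (h x)) \<le> 1"
    proof (intro AE_I2)
      fix x
      have "f x * g x \<le> q x" using f(2)[of x] g(2)[of x] by (simp add: q_def algebra_simps)
      then show "norm (complex_of_real (h x)) \<le> 1"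
        unfolding norm_of_real h_def using f(2)[of x] g(2)[of x] qpos[of x] by simp
    qed
  qed measurable
  have "character_limit \<mu> n c (\<lambda>x. of_real (g x / q x))" "character_limit \<nu> n d (\<lambda>x. of_real (f x / q x))"
  proof -
    have "integrable \<mu> (\<lambda>x. complex_of_real (g x / q x))"
    proof (rule m.integrable_const_bound)
      show "AE x in \<mu>. norm (complex_of_real (g x / q x)) \<le> 1"
        unfolding norm_of_real using q(3) g(2) qpos by (intro AE_I2) (simp add: abs_of_pos)
    qed (simp add: f(3))
    then show "character_limit \<mu> n c (\<lambda>x. of_real (g x / q x))" by (rule m.character_limit_integrable)
    have "integrable \<nu> (\<lambda>x. complex_of_real (f x / q x))"
    proof (rule v.integrable_const_bound)
      show "AE x in \<nu>. norm (complex_of_real (f x / q x)) \<le> 1"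
        unfolding norm_of_real using q(2) f(2) qpos by (intro AE_I2) (simp add: abs_of_pos)
    qed (simp add: g(3))
    then show "character_limit \<nu> n d (\<lambda>x. of_real (f x / q x))" by (rule v.character_limit_integrable)
  qed
  moreover have "(LINT x|\<mu>. x ^ k * of_real (g x / q x)) = (LINT x|\<rho>. x ^ k * of_real (h x))"
    "(LINT x|\<nu>. x ^ k * of_real (f x / q x)) = (LINT x|\<rho>. x ^ k * of_real (h x))" for k
  proof -
    have [measurable]: "(\<lambda>x. x ^ k) \<in> borel_measurable \<rho>" by (rule r.measurable_circle) simp
    show "(LINT x|\<mu>. x ^ k * of_real (g x / q x)) = (LINT x|\<rho>. x ^ k * of_real (h x))"
      unfolding f(3) by (subst integral_density) (auto simp: f(2) h_def scaleR_conv_of_real mult_ac)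
    show "(LINT x|\<nu>. x ^ k * of_real (f x / q x)) = (LINT x|\<rho>. x ^ k * of_real (h x))"
      unfolding g(3) by (subst integral_density) (auto simp: g(2) h_def scaleR_conv_of_real mult_ac)
  qed
  note this[of 0, simplified] this
  ultimately have "(\<lambda>j. LINT x|\<rho>. x ^ n j * of_real (h x)) \<longlonglongrightarrow> c * (LINT x|\<rho>. of_real (h x))"
    "(\<lambda>j. LINT x|\<rho>. x ^ n j * of_real (h x)) \<longlonglongrightarrow> d * (LINT x|\<rho>. of_real (h x))"
    unfolding character_limit_def by simp_all
  then have "c * (LINT x|\<rho>. of_real (h x)) = d * (LINT x|\<rho>. of_real (h x))" by (rule LIMSEQ_unique)
  then have "(LINT x|\<rho>. complex_of_real (h x)) = 0" using cd by simp
  then have h0: "(LINT x|\<rho>. h x) = 0" by (simp add: integral_complex_of_real)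
  have "AE x in \<rho>. h x = 0"
  proof (subst integral_nonneg_eq_0_iff_AE[symmetric])
    show "integrable \<rho> h" using int_h by (simp add: complex_of_real_integrable_eq)
    show "AE x in \<rho>. 0 \<le> h x" using f(2) g(2) qpos by (intro AE_I2) (simp add: h_def less_imp_le)
  qed (use h0 in auto)
  then have fg: "AE x in \<rho>. f x = 0 \<or> g x = 0"
    by eventually_elim (use qpos in \<open>auto simp: h_def less_le\<close>)
  define A where "A = {x \<in> space \<rho>. f x = 0}"
  have A: "A \<in> sets \<rho>" unfolding A_def by measurable
  have "emeasure \<mu> A = (\<integral>\<^sup>+x. ennreal (f x) * indicator A x \<partial>\<rho>)"
    unfolding f(3) by (rule emeasure_density) (use A in auto)
  also have "\<dots> = (\<integral>\<^sup>+x. 0 \<partial>\<rho>)" by (intro nn_integral_cong) (auto simp: A_def indicator_def)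
  finally have "emeasure \<mu> A = 0" by simp
  moreover have "emeasure \<nu> (space \<nu> - A) = 0"
  proof -
    have "emeasure \<nu> (space \<nu> - A) = (\<integral>\<^sup>+x. ennreal (g x) * indicator (space \<rho> - A) x \<partial>\<rho>)"
      unfolding g(3) space_density by (rule emeasure_density) (use A in auto)
    also have "\<dots> = (\<integral>\<^sup>+x. 0 \<partial>\<rho>)"
      using fg by (intro nn_integral_cong_AE) (auto simp: A_def indicator_def elim!: eventually_mono)
    finally show ?thesis by simp
  qed
  ultimately show ?thesis
    unfolding mutually_singular_def using A sets sets_\<rho> by auto
qed


section \<open>Separating different tuples\<close>

text \<open>The \<open>k\<close>-th Fourier coefficient of the measure with mass \<open>1 - p\<close> at \<open>1\<close> and mass \<open>p\<close> at
  \<open>cis \<theta>\<close>.\<close>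

definition two_point_coefficient :: "real \<Rightarrow> real \<Rightarrow> nat \<Rightarrow> complex" where
  "two_point_coefficient p \<theta> k = of_real (1 - p) + of_real p * cis \<theta> ^ k"

text \<open>For fixed \<open>\<theta>\<close> both sides are polynomials in \<open>p\<close>, and they agree at infinitely many points. The factor of
  \<open>k\<close> has the root \<open>1 / (1 - cis (k * \<theta>))\<close>. With \<open>\<theta> = 1 / (L + 1)\<close> the angles \<open>k \<theta>\<close> for
  \<open>k \<le> L\<close> lie in \<open>[0, \<pi>]\<close>, where \<open>cos\<close> is injective, so the multiset of roots determines the
  multiset of the \<open>k\<close>.\<close>

lemma mset_eq_if_two_point_coefficients_eq:
  fixes ks ks' :: "nat list"
  assumes pos: "\<forall>k\<in>set ks \<union> set ks'. 1 \<le> k \<and> k \<le> L"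
    and eq: "\<And>q. (\<Prod>k\<leftarrow>ks. two_point_coefficient (1 / (real q + 1)) (1 / (real L + 1)) k)
        = (\<Prod>k\<leftarrow>ks'. two_point_coefficient (1 / (real q + 1)) (1 / (real L + 1)) k)"
  shows "mset ks = mset ks'"
proof -
  define \<theta> where "\<theta> = 1 / (real L + 1)"
  have cis_inj: "inj_on (\<lambda>k. cis \<theta> ^ k) {0..L}"
  proof (rule inj_onI)
    fix i j assume ij: "i \<in> {0..L}" "j \<in> {0..L}" and "cis \<theta> ^ i = cis \<theta> ^ j"
    then have "cis (real i * \<theta>) = cis (real j * \<theta>)" by (simp only: Complex.DeMoivre)
    then have "cos (real i * \<theta>) = cos (real j * \<theta>)" by (simp add: complex_eq_iff)
    moreover have "0 \<le> real k * \<theta>" "real k * \<theta> \<le> pi" if "k \<in> {0..L}" for k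
    proof -
      show "0 \<le> real k * \<theta>" by (simp add: \<theta>_def)
      have "real k * \<theta> \<le> 1" using that by (simp add: \<theta>_def field_simps)
      then show "real k * \<theta> \<le> pi" using pi_ge_two by simp
    qed
    ultimately have "real i * \<theta> = real j * \<theta>" using ij by (metis cos_inj_pi)
    then show "i = j" by (simp add: \<theta>_def)
  qed
  define a where "a k = 1 - cis \<theta> ^ k" for k
  have a0: "a k \<noteq> 0" if "k \<in> set ks \<union> set ks'" for k
    using inj_onD[OF cis_inj, of 0 k] pos that by (force simp: a_def)
  have a_inj: "inj_on (\<lambda>k. 1 / a k) (set ks \<union> set ks')"
  proof (rule inj_onI)
    fix i j assume ij: "i \<in> set ks \<union> set ks'" "j \<in> set ks \<union> set ks'" and "1 / a i = 1 / a j"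
    then have "a i = a j" using a0[OF ij(1)] a0[OF ij(2)] by simp
    then show "i = j" using inj_onD[OF cis_inj, of i j] pos ij by (auto simp: a_def)
  qed
  define P where "P l = (\<Prod>k\<leftarrow>l. [:1, - a k:])" for l
  have polyP: "poly (P l) (of_real p) = (\<Prod>k\<leftarrow>l. two_point_coefficient p \<theta> k)" for l p
    by (induction l) (simp_all add: P_def a_def two_point_coefficient_def algebra_simps)
  have P0: "P l \<noteq> 0" for l unfolding P_def prod_list_zero_iff by auto
  have rootsP: "proots (P l) = image_mset (\<lambda>k. 1 / a k) (mset l)" if "set l \<subseteq> set ks \<union> set ks'" for l
    using that
  proof (induction l)
    case Nil then show ?case by (simp add: P_def)
  next
    case (Cons k l)
    then have ak: "a k \<noteq> 0" using a0[of k] by simp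
    have "[:1, - a k:] = smult (- a k) [:- (1 / a k), 1:]" using ak by simp
    then have "proots [:1, - a k:] = {#1 / a k#}"
      using ak by (simp only: proots_smult neg_equal_0_iff_equal not_False_eq_True) simp
    moreover have "P (k # l) = [:1, - a k:] * P l" unfolding P_def by (simp only: list.map prod_list.Cons)
    then have "proots (P (k # l)) = proots [:1, - a k:] + proots (P l)"
      using P0[of l] by (simp only: proots_mult pCons_eq_0_iff one_neq_zero not_False_eq_True simp_thms)
    ultimately show ?case using Cons by simp
  qed
  have "P ks = P ks'"
  proof (rule ccontr)
    assume "P ks \<noteq> P ks'"
    then have "finite {x. poly (P ks - P ks') x = 0}" by (intro poly_roots_finite) simp
    moreover have "range (\<lambda>q. complex_of_real (1 / (real q + 1))) \<subseteq> {x. poly (P ks - P ks') x = 0}"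
      using eq unfolding \<theta>_def[symmetric] by (auto simp only: poly_diff polyP diff_self)
    moreover have "inj (\<lambda>q. complex_of_real (1 / (real q + 1)))"
      by (rule injI) (simp add: field_simps)
    ultimately show False using finite_subset finite_imageD by (metis infinite_UNIV_nat)
  qed
  then have "image_mset (\<lambda>k. 1 / a k) (mset ks) = image_mset (\<lambda>k. 1 / a k) (mset ks')"
    using rootsP[of ks] rootsP[of ks'] by simp
  then show ?thesis
    using image_mset_eq_image_mset_plusD[of _ "mset ks" "mset ks'" "{#}"] a_inj by auto
qed


section \<open>The strong operator topology on the unitary group\<close>

lemma topspace_unitary_group: "topspace unitary_group = {u. unitary_operator (blinfun_apply u)}"
  by (simp add: unitary_group_def strong_operator_topology_topspace)

text \<open>Composition is not jointly continuous in the strong operator topology in general; it is here, because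
  unitaries are uniformly bounded.\<close>

lemma continuous_map_unitary_group_power:
  fixes x :: "'h::complex_hilbert_space"
  shows "continuous_map unitary_group euclidean (\<lambda>u. (blinfun_apply u ^^ m) x)"
proof (induction m)
  case 0 then show ?case by simp
next
  case (Suc m)
  show ?case
    unfolding continuous_map_atin limitin_canonical_iff
  proof
    fix v :: "'h \<Rightarrow>\<^sub>L 'h" assume v: "v \<in> topspace unitary_group"
    define y where "y = (blinfun_apply v ^^ m) x"
    have "((\<lambda>u. (blinfun_apply u ^^ m) x) \<longlongrightarrow> y) (atin unitary_group v)"
      using Suc v unfolding continuous_map_atin limitin_canonical_iff y_def by blast
    then have 1: "((\<lambda>u. norm ((blinfun_apply u ^^ m) x - y)) \<longlongrightarrow> 0) (atin unitary_group v)"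
      by (intro tendsto_norm_zero LIM_zero)
    have "continuous_map unitary_group euclidean (\<lambda>u. blinfun_apply u y)"
      unfolding unitary_group_def
      by (intro continuous_map_from_subtopology strong_operator_topology_continuous_evaluation)
    then have "((\<lambda>u. blinfun_apply u y) \<longlongrightarrow> blinfun_apply v y) (atin unitary_group v)"
      using v unfolding continuous_map_atin limitin_canonical_iff by blast
    then have 2: "((\<lambda>u. norm (blinfun_apply u y - blinfun_apply v y)) \<longlongrightarrow> 0) (atin unitary_group v)"
      by (intro tendsto_norm_zero LIM_zero)
    have "\<forall>\<^sub>F u in atin unitary_group v. u \<in> topspace unitary_group"
      unfolding eventually_atin using openin_subset by blast
    then have "\<forall>\<^sub>F u in atin unitary_group v. norm ((blinfun_apply u ^^ Suc m) x - blinfun_apply v y)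
        \<le> norm ((blinfun_apply u ^^ m) x - y) + norm (blinfun_apply u y - blinfun_apply v y)"
    proof eventually_elim
      case (elim u)
      then have "norm (blinfun_apply u ((blinfun_apply u ^^ m) x - y)) = norm ((blinfun_apply u ^^ m) x - y)"
        by (simp add: topspace_unitary_group unitary_norm)
      moreover have "(blinfun_apply u ^^ Suc m) x - blinfun_apply v y
          = blinfun_apply u ((blinfun_apply u ^^ m) x - y) + (blinfun_apply u y - blinfun_apply v y)"
        by (simp add: blinfun.diff_right)
      ultimately show ?case by (metis norm_triangle_ineq)
    qed
    then have "((\<lambda>u. (blinfun_apply u ^^ Suc m) x - blinfun_apply v y) \<longlongrightarrow> 0) (atin unitary_group v)"
      by (rule Lim_null_comparison) (use tendsto_add[OF 1 2] in simp)
    then show "((\<lambda>u. (blinfun_apply u ^^ Suc m) x) \<longlongrightarrow> (blinfun_apply v ^^ Suc m) x) (atin unitary_group v)"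
      unfolding y_def funpow.simps comp_apply by (rule LIM_zero_cancel)
  qed
qed

text \<open>The usual basic strong neighbourhoods, read off from the product topology on functions.\<close>

lemma openin_unitary_group_contains_basis:
  fixes v :: "'h::complex_hilbert_space \<Rightarrow>\<^sub>L 'h"
  assumes T: "openin unitary_group T" and v: "v \<in> T"
  obtains E \<epsilon> where "finite E" "\<epsilon> > 0"
    "\<And>u. u \<in> topspace unitary_group \<Longrightarrow> (\<And>x. x \<in> E \<Longrightarrow> norm (blinfun_apply u x - blinfun_apply v x) < \<epsilon>) \<Longrightarrow> u \<in> T"
proof -
  obtain U :: "('h \<Rightarrow> 'h) set" where U: "open U" "T = blinfun_apply -` U \<inter> topspace unitary_group"
    using T unfolding unitary_group_def strong_operator_topology_def openin_subtopology openin_pullback_topology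
    by (auto simp: topspace_pullback_topology)
  then have "openin (product_topology (\<lambda>_. euclidean) UNIV) U" by (simp add: open_fun_def)
  from product_topology_open_contains_basis[OF this, of "blinfun_apply v"] v U(2)
  obtain X where X: "blinfun_apply v \<in> (\<Pi>\<^sub>E i\<in>UNIV. X i)" "\<And>i. open (X i)" "finite {i. X i \<noteq> UNIV}"
      "(\<Pi>\<^sub>E i\<in>UNIV. X i) \<subseteq> U"
    by auto
  define E where "E = {i. X i \<noteq> UNIV}"
  have "\<exists>e>0. ball (blinfun_apply v i) e \<subseteq> X i" for i
    using X(1,2) by (auto simp: open_contains_ball PiE_iff)
  then obtain e where e: "\<And>i. e i > 0" "\<And>i. ball (blinfun_apply v i) (e i) \<subseteq> X i" by metis
  define \<epsilon> where "\<epsilon> = Min (insert 1 (e ` E))"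
  have fin: "finite E" using X(3) by (simp add: E_def)
  have pos: "\<epsilon> > 0" using fin e(1) by (auto simp: \<epsilon>_def)
  have "u \<in> T" if u: "u \<in> topspace unitary_group" "\<And>x. x \<in> E \<Longrightarrow> norm (blinfun_apply u x - blinfun_apply v x) < \<epsilon>" for u
  proof -
    have "blinfun_apply u i \<in> X i" for i
    proof (cases "i \<in> E")
      case True
      have "\<epsilon> \<le> e i" using fin True by (auto simp: \<epsilon>_def)
      then have "norm (blinfun_apply u i - blinfun_apply v i) < e i" using u(2)[OF True] by simp
      then have "blinfun_apply u i \<in> ball (blinfun_apply v i) (e i)" by (simp add: dist_norm norm_minus_commute)
      then show ?thesis using e(2) by blast
    qed (simp add: E_def)
    then have "blinfun_apply u \<in> U" using X(4) by (auto simp: PiE_iff)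
    then show ?thesis using U(2) u(1) by simp
  qed
  then show thesis using that fin pos by blast
qed


section \<open>The generic set\<close>

text \<open>The intersection over all \<open>N\<close> consists of unitaries \<open>u\<close> with a sequence \<open>n\<close> such that
  \<open>u ^ (k * n j)\<close> tends weakly to \<open>c k\<close> for all \<open>k\<close>, provided that \<open>d\<close> has dense range and
  \<open>c\<close> is bounded by \<open>1\<close>. All \<open>k\<close> share the exponent \<open>M\<close>, which is what makes the limits multiply under
  convolution.\<close>

definition almost_weak_multiples ::
    "(nat \<Rightarrow> 'h::complex_hilbert_space) \<Rightarrow> (nat \<Rightarrow> complex) \<Rightarrow> nat \<Rightarrow> ('h \<Rightarrow>\<^sub>L 'h) set" where
  "almost_weak_multiples d c N = {u \<in> topspace unitary_group. \<exists>M. \<forall>k\<le>N. \<forall>i\<le>N. \<forall>j\<le>N.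
     cmod (cinner ((blinfun_apply u ^^ (k * M)) (d i)) (d j) - c k * cinner (d i) (d j)) < 1 / (real N + 1)}"

lemma openin_almost_weak_multiples: "openin unitary_group (almost_weak_multiples d c N)"
proof -
  have "openin unitary_group {u \<in> topspace unitary_group.
      cmod (cinner ((blinfun_apply u ^^ m) x) y - a) < e}" for m x y a e
  proof -
    have "continuous_map euclidean euclidean (\<lambda>z. cmod (cinner z y - a))"
      unfolding continuous_map_iff_continuous2 continuous_on_def
      by (intro ballI tendsto_intros tendsto_cinner)
    then have "continuous_map unitary_group euclidean (\<lambda>u. cmod (cinner ((blinfun_apply u ^^ m) x) y - a))"
      using continuous_map_compose[OF continuous_map_unitary_group_power, of euclidean "\<lambda>z. cmod (cinner z y - a)" m x]
      by (simp only: comp_def)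
    from openin_continuous_map_preimage[OF this, of "{..<e}"] show ?thesis by simp
  qed
  then have "openin unitary_group (\<Inter>k\<in>{..N}. \<Inter>i\<in>{..N}. \<Inter>j\<in>{..N}. {u \<in> topspace unitary_group.
      cmod (cinner ((blinfun_apply u ^^ (k * M)) (d i)) (d j) - c k * cinner (d i) (d j)) < 1 / (real N + 1)})" for M
    by (intro openin_INT2) auto
  then have "openin unitary_group (\<Union>M. \<Inter>k\<in>{..N}. \<Inter>i\<in>{..N}. \<Inter>j\<in>{..N}. {u \<in> topspace unitary_group.
      cmod (cinner ((blinfun_apply u ^^ (k * M)) (d i)) (d j) - c k * cinner (d i) (d j)) < 1 / (real N + 1)})"
    by blast
  also have "(\<Union>M. \<Inter>k\<in>{..N}. \<Inter>i\<in>{..N}. \<Inter>j\<in>{..N}. {u \<in> topspace unitary_group.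
      cmod (cinner ((blinfun_apply u ^^ (k * M)) (d i)) (d j) - c k * cinner (d i) (d j)) < 1 / (real N + 1)})
     = almost_weak_multiples d c N"
    unfolding almost_weak_multiples_def by auto
  finally show ?thesis .
qed

text \<open>Two towers are used, of masses \<open>p\<close> and \<open>1 - p\<close>, with phases \<open>cis \<theta>\<close> and \<open>1\<close>.\<close>

lemma dense_almost_weak_multiples:
  fixes d :: "nat \<Rightarrow> 'h::complex_hilbert_space"
  assumes inf: "infinite_dimensional TYPE('h)" and p: "0 \<le> p" "p \<le> 1"
  shows "unitary_group closure_of (almost_weak_multiples d (two_point_coefficient p \<theta>) N) = topspace unitary_group"
  unfolding dense_intersects_open
proof (intro allI impI, elim conjE)
  fix T :: "('h \<Rightarrow>\<^sub>L 'h) set"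
  assume T: "openin unitary_group T" "T \<noteq> {}"
  then obtain v where v: "v \<in> T" by blast
  then have v': "unitary_operator (blinfun_apply v)"
    using T(1) openin_subset topspace_unitary_group by blast
  obtain E \<epsilon> where E: "finite E" "\<epsilon> > 0"
    "\<And>u. u \<in> topspace unitary_group \<Longrightarrow> (\<And>x. x \<in> E \<Longrightarrow> norm (blinfun_apply u x - blinfun_apply v x) < \<epsilon>) \<Longrightarrow> u \<in> T"
    using openin_unitary_group_contains_basis[OF T(1) v] by blast
  obtain u M where u: "unitary_operator u"
    "\<And>x. x \<in> E \<union> d ` {..N} \<Longrightarrow> norm (u x - blinfun_apply v x) < \<epsilon>"
    "\<And>k x y. \<lbrakk>x \<in> E \<union> d ` {..N}; y \<in> E \<union> d ` {..N}\<rbrakk> \<Longrightarrow> cinner ((u ^^ (k * M)) x) y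
       = (\<Sum>s\<in>UNIV. of_real (if s then p else 1 - p) * (if s then cis \<theta> else 1) ^ k) * cinner x y"
    by (rule unitary_twisted_tower_near[OF inf v', of "E \<union> d ` {..N}" \<epsilon> "UNIV :: bool set"
          "\<lambda>s. if s then p else 1 - p" "\<lambda>s. if s then cis \<theta> else 1"])
      (use E(1,2) p in \<open>auto simp: UNIV_bool\<close>)
  have coef: "(\<Sum>s\<in>UNIV. of_real (if s then p else 1 - p) * (if s then cis \<theta> else 1) ^ k)
      = two_point_coefficient p \<theta> k" for k
    by (simp add: UNIV_bool two_point_coefficient_def)
  define b where "b = Blinfun u"
  have b: "blinfun_apply b = u" unfolding b_def using unitary_bounded_linear[OF u(1)] by (rule bounded_linear_Blinfun_apply)
  then have "b \<in> topspace unitary_group" using u(1) by (simp add: topspace_unitary_group)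
  moreover from this have "b \<in> T" using E(3) u(2) b by auto
  moreover have "\<forall>k\<le>N. \<forall>i\<le>N. \<forall>j\<le>N. cmod (cinner ((blinfun_apply b ^^ (k * M)) (d i)) (d j)
      - two_point_coefficient p \<theta> k * cinner (d i) (d j)) < 1 / (real N + 1)"
    by (simp add: b u(3) coef)
  ultimately show "almost_weak_multiples d (two_point_coefficient p \<theta>) N \<inter> T \<noteq> {}"
    unfolding almost_weak_multiples_def by blast
qed

lemma cinner_perturbation:
  assumes "unitary_operator u"
  shows "cmod (cinner (u x) y - cinner (u x') y') \<le> norm (x - x') * norm y + norm x' * norm (y - y')"
proof -
  have "cinner (u x) y - cinner (u x') y' = cinner (u (x - x')) y + cinner (u x') (y - y')"
    by (simp add: unitary_diff[OF assms] cinner_diff_left cinner_diff_right)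
  also have "cmod \<dots> \<le> cmod (cinner (u (x - x')) y) + cmod (cinner (u x') (y - y'))"
    by (rule norm_triangle_ineq)
  also have "\<dots> \<le> norm (x - x') * norm y + norm x' * norm (y - y')"
    using Cauchy_Schwarz[of "u (x - x')" y] Cauchy_Schwarz[of "u x'" "y - y'"]
    by (simp add: unitary_norm[OF assms])
  finally show ?thesis .
qed

text \<open>Unitaries are contractions, so convergence of the matrix coefficients on a dense set of vectors
  carries over to all vectors.\<close>

lemma weak_limit_of_powers:
  fixes d :: "nat \<Rightarrow> 'h::complex_hilbert_space"
  assumes dense: "closure (range d) = UNIV" and c: "\<And>k. cmod (c k) \<le> 1"
    and u: "\<And>N. u \<in> almost_weak_multiples d c N"
  obtains n where "\<And>k x y. (\<lambda>j. cinner ((blinfun_apply u ^^ (k * n j)) x) y) \<longlonglongrightarrow> c k * cinner x y"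
proof -
  have "\<forall>N. \<exists>M. \<forall>k\<le>N. \<forall>i\<le>N. \<forall>j\<le>N. cmod (cinner ((blinfun_apply u ^^ (k * M)) (d i)) (d j) - c k * cinner (d i) (d j))
     < 1 / (real N + 1)"
    using u by (simp add: almost_weak_multiples_def)
  then obtain n where n: "\<And>N k i j. \<lbrakk>k \<le> N; i \<le> N; j \<le> N\<rbrakk> \<Longrightarrow>
     cmod (cinner ((blinfun_apply u ^^ (k * n N)) (d i)) (d j) - c k * cinner (d i) (d j)) < 1 / (real N + 1)"
    by metis
  have uni: "unitary_operator (blinfun_apply u)"
    using u[of 0] by (simp add: almost_weak_multiples_def topspace_unitary_group)
  have "(\<lambda>j. cinner ((blinfun_apply u ^^ (k * n j)) x) y) \<longlonglongrightarrow> c k * cinner x y" for k x y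
  proof (rule LIMSEQ_I)
    fix e :: real assume e: "e > 0"
    define K where "K = norm x + norm y + 1"
    have K: "K > 0" by (simp add: K_def add_nonneg_pos)
    define \<delta> where "\<delta> = min 1 (e / (4 * K))"
    have \<delta>: "\<delta> > 0" "\<delta> \<le> 1" using e K by (auto simp: \<delta>_def)
    have "\<exists>i. norm (z - d i) < \<delta>" for z
      using dense \<delta>(1) closure_approachable[of z "range d"] by (auto simp: dist_norm norm_minus_commute)
    then obtain i j where ij: "norm (x - d i) < \<delta>" "norm (y - d j) < \<delta>" by meson
    have small: "norm (x - d i) * norm y + norm (d i) * norm (y - d j) \<le> e / 4"
    proof -
      have "norm (d i) \<le> norm x + 1"
        using norm_triangle_ineq3[of x "d i"] ij(1) \<delta>(2) by linarith
      then have "norm (x - d i) * norm y + norm (d i) * norm (y - d j) \<le> \<delta> * norm y + (norm x + 1) * \<delta>"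
        using ij \<delta>(1) by (intro add_mono mult_mono) auto
      also have "\<dots> = \<delta> * K" by (simp add: K_def algebra_simps)
      also have "\<dots> \<le> e / (4 * K) * K" using K by (intro mult_right_mono) (auto simp: \<delta>_def)
      also have "\<dots> = e / 4" using K by simp
      finally show ?thesis .
    qed
    obtain N0 :: nat where N0: "4 / e < real N0" using reals_Archimedean2 by blast
    have "norm (cinner ((blinfun_apply u ^^ (k * n N)) x) y - c k * cinner x y) < e"
      if N: "N \<ge> Max {N0, k, i, j}" for N
    proof -
      have N': "N0 \<le> N" "k \<le> N" "i \<le> N" "j \<le> N" using N by auto
      have "4 / e < real N + 1" using N0 N'(1) by simp
      then have "1 / (real N + 1) < e / 4" using e by (simp add: field_simps)
      then have mid: "cmod (cinner ((blinfun_apply u ^^ (k * n N)) (d i)) (d j) - c k * cinner (d i) (d j)) < e / 4"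
        using n[OF N'(2-4)] by linarith
      have left: "cmod (cinner ((blinfun_apply u ^^ (k * n N)) x) y - cinner ((blinfun_apply u ^^ (k * n N)) (d i)) (d j)) \<le> e / 4"
        using cinner_perturbation[OF unitary_funpow[OF uni], of "k * n N" x y "d i" "d j"] small by linarith
      have "cmod (c k * (cinner (d i) (d j) - cinner x y)) \<le> 1 * (e / 4)"
        unfolding norm_mult
        using cinner_perturbation[OF unitary_id, of x y "d i" "d j"] small c
        by (intro mult_mono) (auto simp: norm_minus_commute)
      then have right: "cmod (c k * cinner (d i) (d j) - c k * cinner x y) \<le> e / 4"
        by (simp add: right_diff_distrib)
      have tri: "cmod (a - b) \<le> cmod (a - a') + cmod (a' - b') + cmod (b' - b)" for a b a' b' :: complex
        using norm_triangle_ineq[of "a - a'" "a' - b"] norm_triangle_ineq[of "a' - b'" "b' - b"] by simp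
      show ?thesis
        using tri[of "cinner ((blinfun_apply u ^^ (k * n N)) x) y" "c k * cinner x y"
            "cinner ((blinfun_apply u ^^ (k * n N)) (d i)) (d j)" "c k * cinner (d i) (d j)"]
          left mid right e by linarith
    qed
    then show "\<exists>N0. \<forall>N\<ge>N0. norm (cinner ((blinfun_apply u ^^ (k * n N)) x) y - c k * cinner x y) < e" by blast
  qed
  then show thesis by (rule that)
qed

lemma operator_powi_add_nat:
  assumes "bij w"
  shows "operator_powi w (int n + m) x = (w ^^ n) (operator_powi w m x)"
proof (induction n)
  case (Suc n)
  have step: "operator_powi w (1 + k) x = w (operator_powi w k x)" for k
  proof (cases "0 \<le> k")
    case True
    then show ?thesis by (simp add: operator_powi_def nat_add_distrib)
  next
    case False
    then obtain i where i: "k = - int (Suc i)" by (metis int_cases linorder_not_less of_nat_0_le_iff)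
    have "w (inv w z) = z" for z using assms by (simp add: bij_is_surj surj_f_inv_f)
    then show ?thesis by (simp add: i operator_powi_def nat_add_distrib)
  qed
  show ?case using step[of "int n + m"] Suc by (simp add: add.assoc)
qed simp

text \<open>The Fourier coefficient of \<open>\<nu>\<close> at \<open>n j + m\<close> is the matrix coefficient of \<open>u ^ (k * n j)\<close> between
  \<open>u ^ (k * m) \<xi>\<close> and \<open>\<xi>\<close>.\<close>

lemma weak_multiplier_spectral_measure:
  assumes u: "unitary_operator u" and \<nu>: "spectral_measure (u ^^ k) \<xi> \<nu>"
    and n: "\<And>x y. (\<lambda>j. cinner ((u ^^ (k * n j)) x) y) \<longlonglongrightarrow> c * cinner x y"
  shows "weak_multiplier \<nu> n c"
proof -
  have \<nu>': "circle_measure \<nu>" using \<nu> by (simp add: spectral_measure_def circle_measure_iff)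
  have "bij (u ^^ k)" by (rule unitary_bij[OF unitary_funpow[OF u]])
  then show ?thesis
    using \<nu> n unfolding weak_multiplier_iff_Fourier[OF \<nu>'] spectral_measure_def
    by (simp add: operator_powi_add_nat funpow_mult)
qed

lemma cmod_two_point_coefficient:
  assumes "0 \<le> p" "p \<le> 1" shows "cmod (two_point_coefficient p \<theta> k) \<le> 1"
proof -
  have "cmod (two_point_coefficient p \<theta> k) \<le> cmod (of_real (1 - p)) + cmod (of_real p * cis \<theta> ^ k)"
    unfolding two_point_coefficient_def by (rule norm_triangle_ineq)
  also have "\<dots> = 1" using assms unfolding norm_mult norm_power norm_of_real by simp
  finally show ?thesis .
qed


section \<open>Singularity for generic unitaries\<close>

theorem corollary6p1:
  assumes "separable_space (euclidean :: 'h::complex_hilbert_space topology)"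
    and "infinite_dimensional TYPE('h)"
  shows "comeager_in (unitary_group :: ('h \<Rightarrow>\<^sub>L 'h) topology)
    {u \<in> topspace unitary_group.
      \<forall>\<sigma> :: nat \<Rightarrow> complex measure.
        (\<forall>k\<ge>1. maximal_spectral_type (blinfun_apply u ^^ k) (\<sigma> k)) \<longrightarrow>
        (\<forall>(ks :: nat list) (ks' :: nat list).
           ks \<noteq> [] \<and> ks' \<noteq> [] \<and> (\<forall>k\<in>set ks. k \<ge> 1) \<and> (\<forall>k\<in>set ks'. k \<ge> 1) \<and>
           \<not> (\<exists>r. r permutes {..<length ks} \<and> ks' = permute_list r ks) \<longrightarrow>
           mutually_singular (circle_convolutions (map \<sigma> ks)) (circle_convolutions (map \<sigma> ks')))}"
proof -
  obtain C :: "'h set" where C: "countable C" "closure C = UNIV"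
    using assms(1) by (auto simp: separable_space_def)
  then have "C \<noteq> {}" by auto
  define d where "d = from_nat_into C"
  have d: "closure (range d) = UNIV"
    unfolding d_def range_from_nat_into[OF \<open>C \<noteq> {}\<close> C(1)] by (rule C(2))
  define c where "c q L = two_point_coefficient (1 / (real q + 1)) (1 / (real L + 1))" for q L :: nat
  define \<U> where "\<U> = range (\<lambda>(q, L, N). almost_weak_multiples d (c q L) N)"
  have p01: "0 \<le> 1 / (real q + 1)" "1 / (real q + 1) \<le> 1" for q by simp_all
  have c1: "cmod (c q L k) \<le> 1" for q L k unfolding c_def by (rule cmod_two_point_coefficient[OF p01])
  have "countable \<U>" by (simp add: \<U>_def)
  moreover have "openin unitary_group U \<and> unitary_group closure_of U = topspace unitary_group" if "U \<in> \<U>" for U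
    using that dense_almost_weak_multiples[OF assms(2) p01] openin_almost_weak_multiples
    by (force simp: \<U>_def c_def)
  moreover have "mutually_singular (circle_convolutions (map \<sigma> ks)) (circle_convolutions (map \<sigma> ks'))"
    if u: "u \<in> topspace unitary_group" "u \<in> \<Inter>\<U>"
      and \<sigma>: "\<forall>k\<ge>1. maximal_spectral_type (blinfun_apply u ^^ k) (\<sigma> k)"
      and ks: "ks \<noteq> []" "ks' \<noteq> []" "\<forall>k\<in>set ks. k \<ge> 1" "\<forall>k\<in>set ks'. k \<ge> 1"
      and nperm: "\<not> (\<exists>r. r permutes {..<length ks} \<and> ks' = permute_list r ks)"
    for u \<sigma> ks ks'
  proof -
    have uu: "unitary_operator (blinfun_apply u)" using u(1) by (simp add: topspace_unitary_group)
    have "mset ks \<noteq> mset ks'"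
    proof
      assume "mset ks = mset ks'"
      then obtain r where "r permutes {..<length ks}" "permute_list r ks = ks'"
        using mset_eq_permutation[of ks' ks] by metis
      then show False using nperm by blast
    qed
    moreover define L where "L = Max (set ks \<union> set ks')"
    moreover have "\<forall>k\<in>set ks \<union> set ks'. 1 \<le> k \<and> k \<le> L"
      using ks by (auto simp: L_def)
    ultimately obtain q where q: "(\<Prod>k\<leftarrow>ks. c q L k) \<noteq> (\<Prod>k\<leftarrow>ks'. c q L k)"
      using mset_eq_if_two_point_coefficients_eq[of ks ks' L] unfolding c_def by blast
    have in_all: "u \<in> almost_weak_multiples d (c q L) N" for N
      using u(2) by (force simp: \<U>_def)
    obtain n where n: "\<And>k x y. (\<lambda>j. cinner ((blinfun_apply u ^^ (k * n j)) x) y) \<longlonglongrightarrow> c q L k * cinner x y"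
      using weak_limit_of_powers[OF d, of "c q L", OF c1 in_all] by metis
    have \<sigma>': "circle_measure (\<sigma> k)" "weak_multiplier (\<sigma> k) n (c q L k)" if k: "k \<ge> 1" for k
    proof -
      show \<sigma>k: "circle_measure (\<sigma> k)"
        using \<sigma> k by (simp add: maximal_spectral_type_def circle_measure_iff)
      obtain \<xi> \<nu> where \<nu>: "spectral_measure (blinfun_apply u ^^ k) \<xi> \<nu>" "absolutely_continuous \<nu> (\<sigma> k)"
        using \<sigma> k unfolding maximal_spectral_type_def by blast
      then have "circle_measure \<nu>" by (simp add: spectral_measure_def circle_measure_iff)
      then show "weak_multiplier (\<sigma> k) n (c q L k)"
        using weak_multiplier_absolutely_continuous[OF _ weak_multiplier_spectral_measure[OF uu \<nu>(1) n] \<sigma>k \<nu>(2)] by blast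
    qed
    have "circle_measure (circle_convolutions (map \<sigma> l)) \<and>
        weak_multiplier (circle_convolutions (map \<sigma> l)) n (\<Prod>k\<leftarrow>l. c q L k)"
      if "l \<noteq> []" "\<forall>k\<in>set l. k \<ge> 1" for l
      using that \<sigma>' by (intro weak_multiplier_convolutions) auto
    then show ?thesis
      using ks q mutually_singular_if_weak_multipliers_differ by blast
  qed
  ultimately show ?thesis
    unfolding comeager_in_def by (intro conjI exI[of _ \<U>]) auto
qed

end
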